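(* Let $\tilde{\mathcal C}=(\mathcal C,\otimes,\mathbf 1,a,\rho,\lambda)$ be a monoidal category, let $\mathcal M$ be a category, let $(\lozenge,\Psi,u)$ be a right action of $\tilde{\mathcal C}$ on $\mathcal M$, and let $\mathbf T=(T,\mu,\eta)$ be a monad in $\mathcal M$, with Eilenberg–Moore category $\mathcal M^{\mathbf T}$ and forgetful functor $U=U^{\mathbf T}:\mathcal M^{\mathbf T}\to\mathcal M$, $(M,\nu)\mapsto M$. Then there is a natural bijective correspondence $$l\mapsto(\lozenge_l,\Psi_l,u_l)$$ between the distributive laws $l$ from the action $(\lozenge,\Psi,u)$ to the monad $\mathbf T$ and the right actions of $\tilde{\mathcal C}$ on $\mathcal M^{\mathbf T}$ that strictly lift the action $(\lozenge,\Psi,u)$ along $U^{\mathbf T}$. Here $(\lozenge_l,\Psi_l,u_l)$ is given, for $\mathbf T$-modules $(M,\nu)$, objects $Q,Q'$ of $\mathcal C$, morphisms $f$ of $\mathbf T$-modules and morphisms $g$ of $\mathcal C$, by $$(M,\nu)\lozenge_l Q:=\bigl(M\lozenge Q,\ (\nu\lozenge Q)\circ l^Q_M\bigr),\qquad f\lozenge_l g:=f\lozenge g,$$ $$(\Psi_l)^{Q,Q'}_{(M,\nu)}:=\Psi^{Q,Q'}_M,\qquad (u_l)_{(M,\nu)}:=u_M .$$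
   Context: **Monoidal category conventions.** In $\tilde{\mathcal C}=(\mathcal C,\otimes,\mathbf 1,a,\rho,\lambda)$ the natural coherence isomorphisms are directed as $a_{X,Y,Z}:X\otimes(Y\otimes Z)\to(X\otimes Y)\otimes Z$, $\rho_X:X\to X\otimes\mathbf 1$, $\lambda_X:X\to\mathbf 1\otimes X$, and satisfy the usual pentagon and triangle axioms. An object's name also denotes its identity morphism, e.g. $f\lozenge Q=f\lozenge\mathrm{id}_Q$. **Action.** A right action of $\tilde{\mathcal C}$ on a category $\mathcal M$ is a triple $(\lozenge,\Psi,u)$ consisting of a bifunctor $\lozenge:\mathcal M\times\mathcal C\to\mathcal M$, a family of morphisms $\Psi_M^{X,Y}:M\lozenge(X\otimes Y)\to(M\lozenge X)\lozenge Y$ natural in $M,X,Y$, and a natural isomorphism $u:\mathrm{Id}_{\mathcal M}\Rightarrow(\_)\lozenge\mathbf 1$, with components $u_M:M\to M\lozenge\mathbf 1$, such that for all $M\in\mathrm{Ob}\,\mathcal M$ and $X,Y,Z,Q\in\mathrm{Ob}\,\mathcal C$: - $\Psi^{Y,Z}_{M\lozenge X}\circ\Psi_M^{X,Y\otimes Z}=(\Psi_M^{X,Y}\lozenge Z)\circ\Psi_M^{X\otimes Y,Z}\circ(M\lozenge a_{X,Y,Z})$; - $u_M\lozenge Q=\Psi_M^{\mathbf 1,Q}\circ(M\lozenge\lambda_Q)$; - $u_{M\lozenge Q}=\Psi_M^{Q,\mathbf 1}\circ(M\lozenge\rho_Q)$. **Eilenberg–Moore category.** Objects of $\mathcal M^{\mathbf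 T}$ are $\mathbf T$-modules $(M,\nu)$, with $\nu:TM\to M$ satisfying $\nu\circ T(\nu)=\nu\circ\mu_M$ and $\nu\circ\eta_M=\mathrm{id}_M$. Morphisms $(M,\nu)\to(N,\xi)$ are morphisms $f:M\to N$ in $\mathcal M$ with $\xi\circ T(f)=f\circ\nu$. **Distributive law.** A distributive law from an action $(\lozenge,\Psi,u)$ of $\tilde{\mathcal C}$ on $\mathcal M$ to a monad $\mathbf T=(T,\mu,\eta)$ in $\mathcal M$ is a binatural transformation $l:T(\_\lozenge\_)\Rightarrow(T\_)\lozenge\_$ of bifunctors $\mathcal M\times\mathcal C\to\mathcal M$, with components $l^Q_M:T(M\lozenge Q)\to TM\lozenge Q$ natural in both $M$ and $Q$, such that for all $M\in\mathrm{Ob}\,\mathcal M$ and $Q,Q'\in\mathrm{Ob}\,\mathcal C$: - (D1) $(\mu_M\lozenge Q)\circ l^Q_{TM}\circ T(l^Q_M)=l^Q_M\circ\mu_{M\lozenge Q}$; - (D2) $\Psi^{Q,Q'}_{TM}\circ l_M^{Q\otimes Q'}=(l^Q_M\lozenge Q')\circ l^{Q'}_{M\lozenge Q}\circ T(\Psi_M^{Q,Q'})$; - (D3) $l^Q_M\circ\eta_{M\lozenge Q}=\eta_M\lozenge Q$; - (D4) $l^{\mathbf 1}_M\circ T(u_M)=u_{TM}$. **Strict lift.** Let $U:\tilde{\mathcal M}\to\mathcal M$ be a functor and $(\lozenge,\Psi,u)$ an action of $\tilde{\mathcal C}$ on $\mathcal M$. An action $(\tilde\lozenge,\tilde\Psi,\tilde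 u)$ of $\tilde{\mathcal C}$ on $\tilde{\mathcal M}$ is a strict lift of $(\lozenge,\Psi,u)$ along $U$ if $U$ is a strict $\mathcal C$-functor. This means that $U(\_\tilde\lozenge\_)=U(\_)\lozenge\_$ as bifunctors $\tilde{\mathcal M}\times\mathcal C\to\mathcal M$ (on objects and on morphisms), $U(\tilde u_M)=u_{U(M)}$ and $U(\tilde\Psi_M^{Q,Q'})=\Psi_{U(M)}^{Q,Q'}$ for all objects $M$ of $\tilde{\mathcal M}$ and $Q,Q'$ of $\mathcal C$. *)

theory Defs
  imports "HOL-Library.FuncSet"
begin

section \<open>Categories, functors, natural transformations\<close>

text \<open>Every arrow determines its domain and codomain. The operations are meaningful only
  on objects in \<open>Ob\<close>, arrows in \<open>Ar\<close> and composable pairs of arrows;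
  \<open>g \<cdot> f\<close> is ``\<open>g\<close> after \<open>f\<close>''.\<close>

record ('o, 'a) cat =
  Ob :: "'o set"
  Ar :: "'a set"
  Dom :: "'a \<Rightarrow> 'o"
  Cod :: "'a \<Rightarrow> 'o"
  idm :: "'o \<Rightarrow> 'a"
  comp :: "'a \<Rightarrow> 'a \<Rightarrow> 'a"  (infixr "\<cdot>\<index>" 60)

definition Hom :: "('o, 'a, 'x) cat_scheme \<Rightarrow> 'o \<Rightarrow> 'o \<Rightarrow> 'a set" where
  "Hom C X Y = {f \<in> Ar C. Dom C f = X \<and> Cod C f = Y}"

locale category =
  fixes C :: "('o, 'a, 'x) cat_scheme"
  assumes Dom_Ob: "f \<in> Ar C \<Longrightarrow> Dom C f \<in> Ob C"
    and Cod_Ob: "f \<in> Ar C \<Longrightarrow> Cod C f \<in> Ob C"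
    and idm_Hom: "X \<in> Ob C \<Longrightarrow> idm C X \<in> Hom C X X"
    and comp_Hom: "f \<in> Hom C X Y \<Longrightarrow> g \<in> Hom C Y Z \<Longrightarrow> g \<cdot>\<^bsub>C\<^esub> f \<in> Hom C X Z"
    and idm_left: "f \<in> Hom C X Y \<Longrightarrow> idm C Y \<cdot>\<^bsub>C\<^esub> f = f"
    and idm_right: "f \<in> Hom C X Y \<Longrightarrow> f \<cdot>\<^bsub>C\<^esub> idm C X = f"
    and comp_assoc: "f \<in> Hom C W X \<Longrightarrow> g \<in> Hom C X Y \<Longrightarrow> h \<in> Hom C Y Z \<Longrightarrow>
      (h \<cdot>\<^bsub>C\<^esub> g) \<cdot>\<^bsub>C\<^esub> f = h \<cdot>\<^bsub>C\<^esub> (g \<cdot>\<^bsub>C\<^esub> f)"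

definition is_iso :: "('o, 'a, 'x) cat_scheme \<Rightarrow> 'a \<Rightarrow> bool" where
  "is_iso C f \<longleftrightarrow> f \<in> Ar C \<and>
    (\<exists>g \<in> Hom C (Cod C f) (Dom C f).
      g \<cdot>\<^bsub>C\<^esub> f = idm C (Dom C f) \<and> f \<cdot>\<^bsub>C\<^esub> g = idm C (Cod C f))"

definition prod_cat :: "('o, 'a, 'x) cat_scheme \<Rightarrow> ('p, 'b, 'y) cat_scheme \<Rightarrow> ('o \<times> 'p, 'a \<times> 'b) cat"
    (infixr "\<times>\<^sub>c" 75) where
  "C \<times>\<^sub>c D =
    \<lparr>Ob = Ob C \<times> Ob D, Ar = Ar C \<times> Ar D,
     Dom = map_prod (Dom C) (Dom D), Cod = map_prod (Cod C) (Cod D),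
     idm = map_prod (idm C) (idm D),
     comp = (\<lambda>(g, g') (f, f'). (g \<cdot>\<^bsub>C\<^esub> f, g' \<cdot>\<^bsub>D\<^esub> f'))\<rparr>"

record ('o, 'a, 'p, 'b) funct =
  omap :: "'o \<Rightarrow> 'p"
  amap :: "'a \<Rightarrow> 'b"

locale is_functor =
  source: category C + target: category D
  for C :: "('o, 'a, 'x) cat_scheme" and D :: "('p, 'b, 'y) cat_scheme"
    and F :: "('o, 'a, 'p, 'b) funct" +
  assumes omap_Ob: "X \<in> Ob C \<Longrightarrow> omap F X \<in> Ob D"
    and amap_Hom: "f \<in> Hom C X Y \<Longrightarrow> amap F f \<in> Hom D (omap F X) (omap F Y)"
    and amap_idm: "X \<in> Ob C \<Longrightarrow> amap F (idm C X) = idm D (omap F X)"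
    and amap_comp: "f \<in> Hom C X Y \<Longrightarrow> g \<in> Hom C Y Z \<Longrightarrow>
      amap F (g \<cdot>\<^bsub>C\<^esub> f) = amap F g \<cdot>\<^bsub>D\<^esub> amap F f"

definition id_functor :: "('o, 'a, 'o, 'a) funct" where
  "id_functor = \<lparr>omap = (\<lambda>X. X), amap = (\<lambda>f. f)\<rparr>"

definition comp_functor ::
    "('p, 'b, 'q, 'c) funct \<Rightarrow> ('o, 'a, 'p, 'b) funct \<Rightarrow> ('o, 'a, 'q, 'c) funct"
    (infixr "\<circ>\<^sub>F" 65) where
  "G \<circ>\<^sub>F F = \<lparr>omap = (\<lambda>X. omap G (omap F X)), amap = (\<lambda>f. amap G (amap F f))\<rparr>"

locale nat_trans =
  F: is_functor C D F + G: is_functor C D G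
  for C :: "('o, 'a, 'x) cat_scheme" and D :: "('p, 'b, 'y) cat_scheme"
    and F G :: "('o, 'a, 'p, 'b) funct"
    and \<tau> :: "'o \<Rightarrow> 'b" +
  assumes component: "X \<in> Ob C \<Longrightarrow> \<tau> X \<in> Hom D (omap F X) (omap G X)"
    and naturality: "f \<in> Hom C X Y \<Longrightarrow> \<tau> Y \<cdot>\<^bsub>D\<^esub> amap F f = amap G f \<cdot>\<^bsub>D\<^esub> \<tau> X"

locale nat_iso = nat_trans +
  assumes component_iso: "X \<in> Ob C \<Longrightarrow> is_iso D (\<tau> X)"

section \<open>Monoidal categories\<close>

record ('o, 'a) moncat = "('o, 'a) cat" +
  Tensor :: "('o \<times> 'o, 'a \<times> 'a, 'o, 'a) funct"
  Unit :: "'o"  ("\<one>\<index>")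
  assoc :: "'o \<times> 'o \<times> 'o \<Rightarrow> 'a"
  runit :: "'o \<Rightarrow> 'a"
  lunit :: "'o \<Rightarrow> 'a"

abbreviation tensor_ob :: "('o, 'a, 'x) moncat_scheme \<Rightarrow> 'o \<Rightarrow> 'o \<Rightarrow> 'o" (infixl "\<otimes>\<index>" 70) where
  "X \<otimes>\<^bsub>C\<^esub> Y \<equiv> omap (Tensor C) (X, Y)"

abbreviation tensor_ar :: "('o, 'a, 'x) moncat_scheme \<Rightarrow> 'a \<Rightarrow> 'a \<Rightarrow> 'a" (infixl "\<otimes>\<^sub>m\<index>" 70) where
  "f \<otimes>\<^sub>m\<^bsub>C\<^esub> g \<equiv> amap (Tensor C) (f, g)"

text \<open>The coherence isomorphisms point towards the more heavily left-bracketed side: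
  \<open>a\<^sub>X\<^sub>Y\<^sub>Z : X \<otimes> (Y \<otimes> Z) \<rightarrow> (X \<otimes> Y) \<otimes> Z\<close>,
  \<open>\<rho>\<^sub>X : X \<rightarrow> X \<otimes> \<one>\<close> and \<open>\<lambda>\<^sub>X : X \<rightarrow> \<one> \<otimes> X\<close>.\<close>

locale monoidal_category =
  category C + tensor: is_functor "C \<times>\<^sub>c C" C "Tensor C" +
  assoc: nat_iso "C \<times>\<^sub>c C \<times>\<^sub>c C" C
    "\<lparr>omap = (\<lambda>(X, Y, Z). X \<otimes>\<^bsub>C\<^esub> (Y \<otimes>\<^bsub>C\<^esub> Z)),
      amap = (\<lambda>(f, g, h). f \<otimes>\<^sub>m\<^bsub>C\<^esub> (g \<otimes>\<^sub>m\<^bsub>C\<^esub> h))\<rparr>"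
    "\<lparr>omap = (\<lambda>(X, Y, Z). (X \<otimes>\<^bsub>C\<^esub> Y) \<otimes>\<^bsub>C\<^esub> Z),
      amap = (\<lambda>(f, g, h). (f \<otimes>\<^sub>m\<^bsub>C\<^esub> g) \<otimes>\<^sub>m\<^bsub>C\<^esub> h)\<rparr>"
    "assoc C" +
  runit: nat_iso C C id_functor
    "\<lparr>omap = (\<lambda>X. X \<otimes>\<^bsub>C\<^esub> \<one>\<^bsub>C\<^esub>), amap = (\<lambda>f. f \<otimes>\<^sub>m\<^bsub>C\<^esub> idm C \<one>\<^bsub>C\<^esub>)\<rparr>" "runit C" +
  lunit: nat_iso C C id_functor
    "\<lparr>omap = (\<lambda>X. \<one>\<^bsub>C\<^esub> \<otimes>\<^bsub>C\<^esub> X), amap = (\<lambda>f. idm C \<one>\<^bsub>C\<^esub> \<otimes>\<^sub>m\<^bsub>C\<^esub> f)\<rparr>" "lunit C"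
  for C :: "('o, 'a, 'x) moncat_scheme" +
  assumes Unit_Ob: "\<one>\<^bsub>C\<^esub> \<in> Ob C"
    and pentagon: "W \<in> Ob C \<Longrightarrow> X \<in> Ob C \<Longrightarrow> Y \<in> Ob C \<Longrightarrow> Z \<in> Ob C \<Longrightarrow>
      assoc C (W \<otimes>\<^bsub>C\<^esub> X, Y, Z) \<cdot>\<^bsub>C\<^esub> assoc C (W, X, Y \<otimes>\<^bsub>C\<^esub> Z) =
      (assoc C (W, X, Y) \<otimes>\<^sub>m\<^bsub>C\<^esub> idm C Z) \<cdot>\<^bsub>C\<^esub> assoc C (W, X \<otimes>\<^bsub>C\<^esub> Y, Z)
        \<cdot>\<^bsub>C\<^esub> (idm C W \<otimes>\<^sub>m\<^bsub>C\<^esub> assoc C (X, Y, Z))"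
    and triangle: "X \<in> Ob C \<Longrightarrow> Y \<in> Ob C \<Longrightarrow>
      runit C X \<otimes>\<^sub>m\<^bsub>C\<^esub> idm C Y =
      assoc C (X, \<one>\<^bsub>C\<^esub>, Y) \<cdot>\<^bsub>C\<^esub> (idm C X \<otimes>\<^sub>m\<^bsub>C\<^esub> lunit C Y)"

section \<open>Right actions and strict lifts\<close>

text \<open>In \<open>('o, 'm, 'c, 'd) action\<close> the acted-on category has objects \<open>'o\<close> and arrows \<open>'m\<close>,
  the monoidal category has objects \<open>'c\<close> and arrows \<open>'d\<close>. The component
  \<open>\<Psi>\<^sub>X\<^sup>Q\<^sup>R\<close> is \<open>Psi A (X, Q, R)\<close>.\<close>

record ('o, 'm, 'c, 'd) action =
  Act :: "('o \<times> 'c, 'm \<times> 'd, 'o, 'm) funct"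
  Psi :: "'o \<times> 'c \<times> 'c \<Rightarrow> 'm"
  actu :: "'o \<Rightarrow> 'm"

abbreviation act_ob :: "('o, 'm, 'c, 'd) action \<Rightarrow> 'o \<Rightarrow> 'c \<Rightarrow> 'o" (infixl "\<lozenge>\<index>" 70) where
  "X \<lozenge>\<^bsub>A\<^esub> Q \<equiv> omap (Act A) (X, Q)"

abbreviation act_ar :: "('o, 'm, 'c, 'd) action \<Rightarrow> 'm \<Rightarrow> 'd \<Rightarrow> 'm" (infixl "\<lozenge>\<^sub>m\<index>" 70) where
  "f \<lozenge>\<^sub>m\<^bsub>A\<^esub> g \<equiv> amap (Act A) (f, g)"

text \<open>\<open>Psi\<close> is not required to be invertible, whereas \<open>actu\<close> is.\<close>

locale right_action =
  C: monoidal_category C + M: category M +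
  Act: is_functor "M \<times>\<^sub>c C" M "Act A" +
  Psi: nat_trans "M \<times>\<^sub>c C \<times>\<^sub>c C" M
    "\<lparr>omap = (\<lambda>(X, Q, R). X \<lozenge>\<^bsub>A\<^esub> (Q \<otimes>\<^bsub>C\<^esub> R)),
      amap = (\<lambda>(f, g, h). f \<lozenge>\<^sub>m\<^bsub>A\<^esub> (g \<otimes>\<^sub>m\<^bsub>C\<^esub> h))\<rparr>"
    "\<lparr>omap = (\<lambda>(X, Q, R). (X \<lozenge>\<^bsub>A\<^esub> Q) \<lozenge>\<^bsub>A\<^esub> R),
      amap = (\<lambda>(f, g, h). (f \<lozenge>\<^sub>m\<^bsub>A\<^esub> g) \<lozenge>\<^sub>m\<^bsub>A\<^esub> h)\<rparr>"
    "Psi A" +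
  u: nat_iso M M id_functor
    "\<lparr>omap = (\<lambda>X. X \<lozenge>\<^bsub>A\<^esub> \<one>\<^bsub>C\<^esub>), amap = (\<lambda>f. f \<lozenge>\<^sub>m\<^bsub>A\<^esub> idm C \<one>\<^bsub>C\<^esub>)\<rparr>" "actu A"
  for C :: "('c, 'd, 'x) moncat_scheme" and M :: "('o, 'm, 'y) cat_scheme"
    and A :: "('o, 'm, 'c, 'd) action" +
  assumes act_assoc: "X \<in> Ob M \<Longrightarrow> Q \<in> Ob C \<Longrightarrow> R \<in> Ob C \<Longrightarrow> S \<in> Ob C \<Longrightarrow>
      Psi A (X \<lozenge>\<^bsub>A\<^esub> Q, R, S) \<cdot>\<^bsub>M\<^esub> Psi A (X, Q, R \<otimes>\<^bsub>C\<^esub> S) =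
      (Psi A (X, Q, R) \<lozenge>\<^sub>m\<^bsub>A\<^esub> idm C S) \<cdot>\<^bsub>M\<^esub> Psi A (X, Q \<otimes>\<^bsub>C\<^esub> R, S)
        \<cdot>\<^bsub>M\<^esub> (idm M X \<lozenge>\<^sub>m\<^bsub>A\<^esub> assoc C (Q, R, S))"
    and act_lunit: "X \<in> Ob M \<Longrightarrow> Q \<in> Ob C \<Longrightarrow>
      actu A X \<lozenge>\<^sub>m\<^bsub>A\<^esub> idm C Q = Psi A (X, \<one>\<^bsub>C\<^esub>, Q) \<cdot>\<^bsub>M\<^esub> (idm M X \<lozenge>\<^sub>m\<^bsub>A\<^esub> lunit C Q)"
    and act_runit: "X \<in> Ob M \<Longrightarrow> Q \<in> Ob C \<Longrightarrow>
      actu A (X \<lozenge>\<^bsub>A\<^esub> Q) = Psi A (X, Q, \<one>\<^bsub>C\<^esub>) \<cdot>\<^bsub>M\<^esub> (idm M X \<lozenge>\<^sub>m\<^bsub>A\<^esub> runit C Q)"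

locale strict_lift =
  base: right_action C M A + lifted: right_action C N B + U: is_functor N M U
  for C :: "('c, 'd, 'x) moncat_scheme"
    and N :: "('p, 'n, 'z) cat_scheme" and M :: "('o, 'm, 'y) cat_scheme"
    and U :: "('p, 'n, 'o, 'm) funct"
    and A :: "('o, 'm, 'c, 'd) action" and B :: "('p, 'n, 'c, 'd) action" +
  assumes lift_ob: "X \<in> Ob N \<Longrightarrow> Q \<in> Ob C \<Longrightarrow> omap U (X \<lozenge>\<^bsub>B\<^esub> Q) = omap U X \<lozenge>\<^bsub>A\<^esub> Q"
    and lift_ar: "f \<in> Ar N \<Longrightarrow> g \<in> Ar C \<Longrightarrow> amap U (f \<lozenge>\<^sub>m\<^bsub>B\<^esub> g) = amap U f \<lozenge>\<^sub>m\<^bsub>A\<^esub> g"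
    and lift_u: "X \<in> Ob N \<Longrightarrow> amap U (actu B X) = actu A (omap U X)"
    and lift_Psi: "X \<in> Ob N \<Longrightarrow> Q \<in> Ob C \<Longrightarrow> R \<in> Ob C \<Longrightarrow>
      amap U (Psi B (X, Q, R)) = Psi A (omap U X, Q, R)"

section \<open>Monads and their Eilenberg--Moore categories\<close>

record ('o, 'm) monad =
  Tf :: "('o, 'm, 'o, 'm) funct"
  mu :: "'o \<Rightarrow> 'm"
  eta :: "'o \<Rightarrow> 'm"

locale monad_on =
  category M + T: is_functor M M "Tf T" +
  mu: nat_trans M M "Tf T \<circ>\<^sub>F Tf T" "Tf T" "mu T" +
  eta: nat_trans M M id_functor "Tf T" "eta T"
  for M :: "('o, 'm, 'y) cat_scheme" and T :: "('o, 'm) monad" +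
  assumes mu_assoc: "X \<in> Ob M \<Longrightarrow>
      mu T X \<cdot>\<^bsub>M\<^esub> amap (Tf T) (mu T X) = mu T X \<cdot>\<^bsub>M\<^esub> mu T (omap (Tf T) X)"
    and mu_eta_left: "X \<in> Ob M \<Longrightarrow> mu T X \<cdot>\<^bsub>M\<^esub> eta T (omap (Tf T) X) = idm M (omap (Tf T) X)"
    and mu_eta_right: "X \<in> Ob M \<Longrightarrow> mu T X \<cdot>\<^bsub>M\<^esub> amap (Tf T) (eta T X) = idm M (omap (Tf T) X)"

definition is_module :: "('o, 'm, 'y) cat_scheme \<Rightarrow> ('o, 'm) monad \<Rightarrow> 'o \<times> 'm \<Rightarrow> bool" where
  "is_module M T = (\<lambda>(X, \<nu>). X \<in> Ob M \<and> \<nu> \<in> Hom M (omap (Tf T) X) X \<and>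
     \<nu> \<cdot>\<^bsub>M\<^esub> amap (Tf T) \<nu> = \<nu> \<cdot>\<^bsub>M\<^esub> mu T X \<and> \<nu> \<cdot>\<^bsub>M\<^esub> eta T X = idm M X)"

definition is_module_map ::
    "('o, 'm, 'y) cat_scheme \<Rightarrow> ('o, 'm) monad \<Rightarrow> 'o \<times> 'm \<Rightarrow> 'm \<Rightarrow> 'o \<times> 'm \<Rightarrow> bool" where
  "is_module_map M T = (\<lambda>(X, \<nu>) f (Y, \<xi>). f \<in> Hom M X Y \<and>
     \<xi> \<cdot>\<^bsub>M\<^esub> amap (Tf T) f = f \<cdot>\<^bsub>M\<^esub> \<nu>)"

text \<open>The same arrow of \<open>M\<close> may underlie module maps between different modules, so an arrow of
  the Eilenberg--Moore category is a triple of source module, underlying arrow and target module.\<close>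

type_synonym ('o, 'm) em_ob = "'o \<times> 'm"
type_synonym ('o, 'm) em_ar = "('o \<times> 'm) \<times> 'm \<times> ('o \<times> 'm)"

definition EM :: "('o, 'm, 'y) cat_scheme \<Rightarrow> ('o, 'm) monad \<Rightarrow> (('o, 'm) em_ob, ('o, 'm) em_ar) cat" where
  "EM M T =
    \<lparr>Ob = {P. is_module M T P},
     Ar = {(P, f, R). is_module M T P \<and> is_module M T R \<and> is_module_map M T P f R},
     Dom = (\<lambda>(P, f, R). P),
     Cod = (\<lambda>(P, f, R). R),
     idm = (\<lambda>P. (P, idm M (fst P), P)),
     comp = (\<lambda>(P', g, R') (P, f, R). (P, g \<cdot>\<^bsub>M\<^esub> f, R'))\<rparr>"

definition forgetful :: "(('o, 'm) em_ob, ('o, 'm) em_ar, 'o, 'm) funct" where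
  "forgetful = \<lparr>omap = fst, amap = (\<lambda>(P, f, R). f)\<rparr>"

section \<open>Distributive laws and the induced actions\<close>

text \<open>The component \<open>l\<^sub>X\<^sup>Q\<close> is \<open>l (X, Q)\<close>.\<close>

locale distributive_law =
  act: right_action C M A + monad: monad_on M T +
  l: nat_trans "M \<times>\<^sub>c C" M
    "\<lparr>omap = (\<lambda>(X, Q). omap (Tf T) (X \<lozenge>\<^bsub>A\<^esub> Q)), amap = (\<lambda>(f, g). amap (Tf T) (f \<lozenge>\<^sub>m\<^bsub>A\<^esub> g))\<rparr>"
    "\<lparr>omap = (\<lambda>(X, Q). omap (Tf T) X \<lozenge>\<^bsub>A\<^esub> Q), amap = (\<lambda>(f, g). amap (Tf T) f \<lozenge>\<^sub>m\<^bsub>A\<^esub> g)\<rparr>"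
    l
  for C :: "('c, 'd, 'x) moncat_scheme" and M :: "('o, 'm, 'y) cat_scheme"
    and A :: "('o, 'm, 'c, 'd) action" and T :: "('o, 'm) monad"
    and l :: "'o \<times> 'c \<Rightarrow> 'm" +
  assumes D1: "X \<in> Ob M \<Longrightarrow> Q \<in> Ob C \<Longrightarrow>
      (mu T X \<lozenge>\<^sub>m\<^bsub>A\<^esub> idm C Q) \<cdot>\<^bsub>M\<^esub> l (omap (Tf T) X, Q) \<cdot>\<^bsub>M\<^esub> amap (Tf T) (l (X, Q)) =
      l (X, Q) \<cdot>\<^bsub>M\<^esub> mu T (X \<lozenge>\<^bsub>A\<^esub> Q)"
    and D2: "X \<in> Ob M \<Longrightarrow> Q \<in> Ob C \<Longrightarrow> R \<in> Ob C \<Longrightarrow>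
      Psi A (omap (Tf T) X, Q, R) \<cdot>\<^bsub>M\<^esub> l (X, Q \<otimes>\<^bsub>C\<^esub> R) =
      (l (X, Q) \<lozenge>\<^sub>m\<^bsub>A\<^esub> idm C R) \<cdot>\<^bsub>M\<^esub> l (X \<lozenge>\<^bsub>A\<^esub> Q, R) \<cdot>\<^bsub>M\<^esub> amap (Tf T) (Psi A (X, Q, R))"
    and D3: "X \<in> Ob M \<Longrightarrow> Q \<in> Ob C \<Longrightarrow>
      l (X, Q) \<cdot>\<^bsub>M\<^esub> eta T (X \<lozenge>\<^bsub>A\<^esub> Q) = eta T X \<lozenge>\<^sub>m\<^bsub>A\<^esub> idm C Q"
    and D4: "X \<in> Ob M \<Longrightarrow>
      l (X, \<one>\<^bsub>C\<^esub>) \<cdot>\<^bsub>M\<^esub> amap (Tf T) (actu A X) = actu A (omap (Tf T) X)"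

text \<open>HOL functions are total, so one mathematical family is represented by many functions that
  differ outside the category. To count each law and each action once, the
  two sets below contain only the representatives that are \<open>undefined\<close> there.\<close>

definition distributive_laws ::
    "('c, 'd, 'x) moncat_scheme \<Rightarrow> ('o, 'm, 'y) cat_scheme \<Rightarrow> ('o, 'm, 'c, 'd) action \<Rightarrow>
     ('o, 'm) monad \<Rightarrow> ('o \<times> 'c \<Rightarrow> 'm) set" where
  "distributive_laws C M A T =
    {l. distributive_law C M A T l \<and> l \<in> extensional (Ob M \<times> Ob C)}"

definition extensional_action ::
    "('c, 'd, 'x) moncat_scheme \<Rightarrow> ('o, 'm, 'y) cat_scheme \<Rightarrow> ('o, 'm, 'c, 'd) action \<Rightarrow> bool" where
  "extensional_action C M A \<longleftrightarrow>
     omap (Act A) \<in> extensional (Ob M \<times> Ob C) \<and>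
     amap (Act A) \<in> extensional (Ar M \<times> Ar C) \<and>
     Psi A \<in> extensional (Ob M \<times> Ob C \<times> Ob C) \<and>
     actu A \<in> extensional (Ob M)"

definition strict_lifts ::
    "('c, 'd, 'x) moncat_scheme \<Rightarrow> ('o, 'm, 'y) cat_scheme \<Rightarrow> ('o, 'm, 'c, 'd) action \<Rightarrow>
     ('o, 'm) monad \<Rightarrow> (('o, 'm) em_ob, ('o, 'm) em_ar, 'c, 'd) action set" where
  "strict_lifts C M A T =
    {B. strict_lift C (EM M T) M forgetful A B \<and> extensional_action C (EM M T) B}"

definition lift_ob_of ::
    "('c, 'd, 'x) moncat_scheme \<Rightarrow> ('o, 'm, 'y) cat_scheme \<Rightarrow> ('o, 'm, 'c, 'd) action \<Rightarrow>
     ('o \<times> 'c \<Rightarrow> 'm) \<Rightarrow> ('o, 'm) em_ob \<Rightarrow> 'c \<Rightarrow> ('o, 'm) em_ob" where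
  "lift_ob_of C M A l = (\<lambda>(X, \<nu>) Q. (X \<lozenge>\<^bsub>A\<^esub> Q, (\<nu> \<lozenge>\<^sub>m\<^bsub>A\<^esub> idm C Q) \<cdot>\<^bsub>M\<^esub> l (X, Q)))"

text \<open>The components of the lifted \<open>\<Psi>\<close> and \<open>u\<close>, and the action of the lifted bifunctor on arrows,
  have the underlying arrows \<open>Psi A (fst P, Q, R)\<close>, \<open>actu A (fst P)\<close> and \<open>f \<lozenge>\<^sub>m\<^bsub>A\<^esub> g\<close>;
  the outer entries of the triples are their source and target modules.\<close>

definition lift_of ::
    "('c, 'd, 'x) moncat_scheme \<Rightarrow> ('o, 'm, 'y) cat_scheme \<Rightarrow> ('o, 'm, 'c, 'd) action \<Rightarrow>
     ('o, 'm) monad \<Rightarrow> ('o \<times> 'c \<Rightarrow> 'm) \<Rightarrow> (('o, 'm) em_ob, ('o, 'm) em_ar, 'c, 'd) action" where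
  "lift_of C M A T l = (let L = lift_ob_of C M A l in
    \<lparr>Act = \<lparr>omap = (\<lambda>(P, Q) \<in> Ob (EM M T) \<times> Ob C. L P Q),
            amap = (\<lambda>((P, f, R), g) \<in> Ar (EM M T) \<times> Ar C.
                      (L P (Dom C g), f \<lozenge>\<^sub>m\<^bsub>A\<^esub> g, L R (Cod C g)))\<rparr>,
     Psi = (\<lambda>(P, Q, R) \<in> Ob (EM M T) \<times> Ob C \<times> Ob C.
              (L P (Q \<otimes>\<^bsub>C\<^esub> R), Psi A (fst P, Q, R), L (L P Q) R)),
     actu = (\<lambda>P \<in> Ob (EM M T). (P, actu A (fst P), L P \<one>\<^bsub>C\<^esub>))\<rparr>)"

end

theory Submission
  imports Defs
begin

text \<open>A lift assigns to a module \<open>(X, \<nu>)\<close> and an object \<open>Q\<close> a structure map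
  \<open>\<sigma>\<close> on \<open>X \<lozenge> Q\<close>. It is recovered from a law as \<open>\<sigma> = (\<nu> \<lozenge> Q) \<circ> l\<close>; conversely the law is
  \<open>l\<^sub>X = \<sigma> \<circ> T(\<eta>\<^sub>X \<lozenge> Q)\<close> with \<open>\<sigma>\<close> taken at the free module \<open>(T X, \<mu>\<^sub>X)\<close>. D1 and D3 make \<open>\<sigma>\<close> a
  module structure, D2 and D4 make \<open>\<Psi>\<close> and \<open>u\<close> module maps, and the coherence conditions
  are inherited because the forgetful functor is faithful.\<close>

section \<open>Arrow-wise forms of the axioms\<close>

text \<open>Premises phrased with \<open>Ar\<close>, \<open>Dom\<close> and \<open>Cod\<close> instead of \<open>Hom\<close> contain no variables
  absent from the conclusion, so the simplifier can discharge them.\<close>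

context category
begin

lemma comp_Ar [simp]:
  assumes "f \<in> Ar C" "g \<in> Ar C" "Cod C f = Dom C g"
  shows "g \<cdot>\<^bsub>C\<^esub> f \<in> Ar C"
    and "Dom C (g \<cdot>\<^bsub>C\<^esub> f) = Dom C f"
    and "Cod C (g \<cdot>\<^bsub>C\<^esub> f) = Cod C g"
  using comp_Hom[of f "Dom C f" "Dom C g" g "Cod C g"] assms by (auto simp: Hom_def)

lemma idm_Ar [simp]:
  assumes "X \<in> Ob C"
  shows "idm C X \<in> Ar C" "Dom C (idm C X) = X" "Cod C (idm C X) = X"
  using idm_Hom[OF assms] by (auto simp: Hom_def)

lemma idm_comp [simp]: "f \<in> Ar C \<Longrightarrow> Cod C f = Y \<Longrightarrow> idm C Y \<cdot>\<^bsub>C\<^esub> f = f"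
  by (rule idm_left) (auto simp: Hom_def)

lemma comp_idm [simp]: "f \<in> Ar C \<Longrightarrow> Dom C f = X \<Longrightarrow> f \<cdot>\<^bsub>C\<^esub> idm C X = f"
  by (rule idm_right) (auto simp: Hom_def)

lemma comp_assoc_Ar [simp]:
  "f \<in> Ar C \<Longrightarrow> g \<in> Ar C \<Longrightarrow> h \<in> Ar C \<Longrightarrow> Cod C f = Dom C g \<Longrightarrow> Cod C g = Dom C h \<Longrightarrow>
    (h \<cdot>\<^bsub>C\<^esub> g) \<cdot>\<^bsub>C\<^esub> f = h \<cdot>\<^bsub>C\<^esub> (g \<cdot>\<^bsub>C\<^esub> f)"
  by (rule comp_assoc) (auto simp: Hom_def)

lemma Dom_Cod_Ob [simp]: "f \<in> Ar C \<Longrightarrow> Dom C f \<in> Ob C" "f \<in> Ar C \<Longrightarrow> Cod C f \<in> Ob C"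
  by (rule Dom_Ob Cod_Ob; assumption)+

end

text \<open>Composability appears as an equation between \<open>Cod\<close> and \<open>Dom\<close>,
  so arrows of product and Eilenberg-Moore categories can be split into their entries with no
  hom-set endpoints left to instantiate.\<close>

lemma categoryI:
  assumes "\<And>f. f \<in> Ar C \<Longrightarrow> Dom C f \<in> Ob C \<and> Cod C f \<in> Ob C"
    and "\<And>X. X \<in> Ob C \<Longrightarrow> idm C X \<in> Hom C X X"
    and "\<And>f g. f \<in> Ar C \<Longrightarrow> g \<in> Ar C \<Longrightarrow> Cod C f = Dom C g \<Longrightarrow> g \<cdot>\<^bsub>C\<^esub> f \<in> Hom C (Dom C f) (Cod C g)"
    and "\<And>f. f \<in> Ar C \<Longrightarrow> idm C (Cod C f) \<cdot>\<^bsub>C\<^esub> f = f \<and> f \<cdot>\<^bsub>C\<^esub> idm C (Dom C f) = f"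
    and "\<And>f g h. f \<in> Ar C \<Longrightarrow> g \<in> Ar C \<Longrightarrow> h \<in> Ar C \<Longrightarrow> Cod C f = Dom C g \<Longrightarrow> Cod C g = Dom C h \<Longrightarrow>
      (h \<cdot>\<^bsub>C\<^esub> g) \<cdot>\<^bsub>C\<^esub> f = h \<cdot>\<^bsub>C\<^esub> (g \<cdot>\<^bsub>C\<^esub> f)"
  shows "category C"
  by unfold_locales (use assms in \<open>auto simp: Hom_def\<close>)

lemma is_functorI:
  assumes "category C" "category D"
    and "\<And>X. X \<in> Ob C \<Longrightarrow> omap F X \<in> Ob D"
    and "\<And>f. f \<in> Ar C \<Longrightarrow> amap F f \<in> Hom D (omap F (Dom C f)) (omap F (Cod C f))"
    and "\<And>X. X \<in> Ob C \<Longrightarrow> amap F (idm C X) = idm D (omap F X)"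
    and "\<And>f g. f \<in> Ar C \<Longrightarrow> g \<in> Ar C \<Longrightarrow> Cod C f = Dom C g \<Longrightarrow>
      amap F (g \<cdot>\<^bsub>C\<^esub> f) = amap F g \<cdot>\<^bsub>D\<^esub> amap F f"
  shows "is_functor C D F"
  using assms by (auto simp: is_functor_def is_functor_axioms_def Hom_def)

lemma nat_transI:
  assumes "is_functor C D F" "is_functor C D G"
    and "\<And>X. X \<in> Ob C \<Longrightarrow> \<tau> X \<in> Hom D (omap F X) (omap G X)"
    and "\<And>f. f \<in> Ar C \<Longrightarrow> \<tau> (Cod C f) \<cdot>\<^bsub>D\<^esub> amap F f = amap G f \<cdot>\<^bsub>D\<^esub> \<tau> (Dom C f)"
  shows "nat_trans C D F G \<tau>"
  using assms by (auto simp: nat_trans_def nat_trans_axioms_def Hom_def)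

context is_functor
begin

lemma amap_Ar [simp]:
  assumes "f \<in> Ar C"
  shows "amap F f \<in> Ar D" "Dom D (amap F f) = omap F (Dom C f)" "Cod D (amap F f) = omap F (Cod C f)"
  using amap_Hom[of f "Dom C f" "Cod C f"] assms by (auto simp: Hom_def)

text \<open>Kept out of the simp set because later proofs use it in both directions: some split
  \<open>T\<close> over a composite, others merge two images under \<open>T\<close>.\<close>

lemma amap_comp_Ar:
  "f \<in> Ar C \<Longrightarrow> g \<in> Ar C \<Longrightarrow> Cod C f = Dom C g \<Longrightarrow>
    amap F (g \<cdot>\<^bsub>C\<^esub> f) = amap F g \<cdot>\<^bsub>D\<^esub> amap F f"
  by (rule amap_comp) (auto simp: Hom_def)

declare omap_Ob [simp] amap_idm [simp]

end

context nat_trans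
begin

lemma component_Ar:
  assumes "X \<in> Ob C"
  shows "\<tau> X \<in> Ar D" "Dom D (\<tau> X) = omap F X" "Cod D (\<tau> X) = omap G X"
  using component[OF assms] by (auto simp: Hom_def)

lemma naturality_Ar:
  "f \<in> Ar C \<Longrightarrow> \<tau> (Cod C f) \<cdot>\<^bsub>D\<^esub> amap F f = amap G f \<cdot>\<^bsub>D\<^esub> \<tau> (Dom C f)"
  by (rule naturality) (auto simp: Hom_def)

end

section \<open>Product categories\<close>

lemma prod_cat_simps [simp]:
  "Ob (C \<times>\<^sub>c D) = Ob C \<times> Ob D"
  "Ar (C \<times>\<^sub>c D) = Ar C \<times> Ar D"
  "Dom (C \<times>\<^sub>c D) (f, g) = (Dom C f, Dom D g)"
  "Cod (C \<times>\<^sub>c D) (f, g) = (Cod C f, Cod D g)"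
  "idm (C \<times>\<^sub>c D) (X, Y) = (idm C X, idm D Y)"
  "(f', g') \<cdot>\<^bsub>C \<times>\<^sub>c D\<^esub> (f, g) = (f' \<cdot>\<^bsub>C\<^esub> f, g' \<cdot>\<^bsub>D\<^esub> g)"
  by (simp_all add: prod_cat_def)

lemma category_prod_cat:
  assumes "category C" "category D"
  shows "category (C \<times>\<^sub>c D)"
proof -
  interpret C: category C by fact
  interpret D: category D by fact
  show ?thesis by (rule categoryI) (auto simp: Hom_def)
qed

section \<open>The Eilenberg--Moore category\<close>

lemma EM_simps [simp]:
  "P \<in> Ob (EM M T) \<longleftrightarrow> is_module M T P"
  "(P, f, R) \<in> Ar (EM M T) \<longleftrightarrow> is_module M T P \<and> is_module M T R \<and> is_module_map M T P f R"
  "Dom (EM M T) t = fst t"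
  "Cod (EM M T) t = snd (snd t)"
  "idm (EM M T) P = (P, idm M (fst P), P)"
  "(P', g, R') \<cdot>\<^bsub>EM M T\<^esub> (P, f, R) = (P, g \<cdot>\<^bsub>M\<^esub> f, R')"
  by (simp_all add: EM_def split: prod.split)

lemma forgetful_simps [simp]:
  "omap forgetful P = fst P" "amap forgetful t = fst (snd t)"
  by (simp_all add: forgetful_def split: prod.split)

context monad_on
begin

abbreviation Tob :: "'o \<Rightarrow> 'o" where "Tob X \<equiv> omap (Tf T) X"
abbreviation Tar :: "'m \<Rightarrow> 'm" where "Tar f \<equiv> amap (Tf T) f"

lemma mu_Ar [simp]:
  assumes "X \<in> Ob M"
  shows "mu T X \<in> Ar M" "Dom M (mu T X) = Tob (Tob X)" "Cod M (mu T X) = Tob X"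
  using mu.component_Ar[OF assms] by (auto simp: comp_functor_def)

lemma eta_Ar [simp]:
  assumes "X \<in> Ob M"
  shows "eta T X \<in> Ar M" "Dom M (eta T X) = X" "Cod M (eta T X) = Tob X"
  using eta.component_Ar[OF assms] by (auto simp: id_functor_def)

lemma mu_nat: "f \<in> Ar M \<Longrightarrow> mu T (Cod M f) \<cdot>\<^bsub>M\<^esub> Tar (Tar f) = Tar f \<cdot>\<^bsub>M\<^esub> mu T (Dom M f)"
  using mu.naturality_Ar[of f] by (simp add: comp_functor_def)

lemma eta_nat: "f \<in> Ar M \<Longrightarrow> eta T (Cod M f) \<cdot>\<^bsub>M\<^esub> f = Tar f \<cdot>\<^bsub>M\<^esub> eta T (Dom M f)"
  using eta.naturality_Ar[of f] by (simp add: id_functor_def)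

lemma is_module_Pair:
  "is_module M T (X, \<nu>) \<longleftrightarrow> X \<in> Ob M \<and> \<nu> \<in> Ar M \<and> Dom M \<nu> = Tob X \<and> Cod M \<nu> = X \<and>
     \<nu> \<cdot>\<^bsub>M\<^esub> Tar \<nu> = \<nu> \<cdot>\<^bsub>M\<^esub> mu T X \<and> \<nu> \<cdot>\<^bsub>M\<^esub> eta T X = idm M X"
  by (auto simp: is_module_def Hom_def)

text \<open>Projections instead of a pair pattern let the simplifier treat modules given by a term,
  such as \<open>lift_ob P Q\<close>, without a case distinction.\<close>

lemma is_module_iff:
  "is_module M T P \<longleftrightarrow> fst P \<in> Ob M \<and> snd P \<in> Ar M \<and> Dom M (snd P) = Tob (fst P) \<and>
     Cod M (snd P) = fst P \<and> snd P \<cdot>\<^bsub>M\<^esub> Tar (snd P) = snd P \<cdot>\<^bsub>M\<^esub> mu T (fst P) \<and>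
     snd P \<cdot>\<^bsub>M\<^esub> eta T (fst P) = idm M (fst P)"
  by (cases P) (simp add: is_module_Pair)

lemma is_module_map_iff:
  "is_module_map M T P f R \<longleftrightarrow> f \<in> Ar M \<and> Dom M f = fst P \<and> Cod M f = fst R \<and>
     snd R \<cdot>\<^bsub>M\<^esub> Tar f = f \<cdot>\<^bsub>M\<^esub> snd P"
  by (cases P; cases R) (auto simp: is_module_map_def Hom_def)

lemma is_moduleD:
  assumes "is_module M T P"
  shows "fst P \<in> Ob M" "snd P \<in> Ar M" "Dom M (snd P) = Tob (fst P)" "Cod M (snd P) = fst P"
    and "snd P \<cdot>\<^bsub>M\<^esub> Tar (snd P) = snd P \<cdot>\<^bsub>M\<^esub> mu T (fst P)"
    and "snd P \<cdot>\<^bsub>M\<^esub> eta T (fst P) = idm M (fst P)"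
  using assms by (simp_all add: is_module_iff)

lemma is_module_mapD:
  assumes "is_module_map M T P f R"
  shows "f \<in> Ar M" "Dom M f = fst P" "Cod M f = fst R" "snd R \<cdot>\<^bsub>M\<^esub> Tar f = f \<cdot>\<^bsub>M\<^esub> snd P"
  using assms by (simp_all add: is_module_map_iff)

lemma is_module_map_idm:
  "is_module M T P \<Longrightarrow> is_module_map M T P (idm M (fst P)) P"
  by (simp add: is_module_iff is_module_map_iff)

text \<open>The squares of \<open>f\<close> and \<open>g\<close> paste along the structure map of
  \<open>Q\<close>.\<close>

lemma is_module_map_comp:
  assumes P: "is_module M T P" "is_module M T Q" "is_module M T R"
    and f: "is_module_map M T P f Q" and g: "is_module_map M T Q g R"
  shows "is_module_map M T P (g \<cdot>\<^bsub>M\<^esub> f) R"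
proof -
  note [simp] = P[THEN is_moduleD(1)] P[THEN is_moduleD(2)] P[THEN is_moduleD(3)] P[THEN is_moduleD(4)]
    is_module_mapD(1-3)[OF f] is_module_mapD(1-3)[OF g]
  have "snd R \<cdot>\<^bsub>M\<^esub> Tar (g \<cdot>\<^bsub>M\<^esub> f) = (snd R \<cdot>\<^bsub>M\<^esub> Tar g) \<cdot>\<^bsub>M\<^esub> Tar f"
    by (simp add: T.amap_comp_Ar)
  also have "\<dots> = g \<cdot>\<^bsub>M\<^esub> (snd Q \<cdot>\<^bsub>M\<^esub> Tar f)"
    unfolding is_module_mapD(4)[OF g] by simp
  also have "\<dots> = (g \<cdot>\<^bsub>M\<^esub> f) \<cdot>\<^bsub>M\<^esub> snd P"
    unfolding is_module_mapD(4)[OF f] by simp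
  finally show ?thesis by (simp add: is_module_map_iff)
qed

lemma category_EM: "category (EM M T)"
proof (rule categoryI)
  fix f g assume "f \<in> Ar (EM M T)" "g \<in> Ar (EM M T)" "Cod (EM M T) f = Dom (EM M T) g"
  then show "g \<cdot>\<^bsub>EM M T\<^esub> f \<in> Hom (EM M T) (Dom (EM M T) f) (Cod (EM M T) g)"
    by (cases f; cases g) (auto simp: Hom_def intro: is_module_map_comp)
qed (auto simp: Hom_def is_module_map_iff is_module_iff)

lemma is_functor_forgetful: "is_functor (EM M T) M forgetful"
  by (rule is_functorI[OF category_EM]) 
    (auto simp: Hom_def category_axioms is_module_map_iff dest: is_moduleD)

text \<open>The two module axioms for a free module are the associativity law of the monad and one
  of its unit laws.\<close>

lemma is_module_free: "X \<in> Ob M \<Longrightarrow> is_module M T (Tob X, mu T X)"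
  by (simp add: is_module_iff mu_assoc mu_eta_left)

lemma is_module_map_free:
  "f \<in> Ar M \<Longrightarrow> is_module_map M T (Tob (Dom M f), mu T (Dom M f)) (Tar f) (Tob (Cod M f), mu T (Cod M f))"
  by (simp add: is_module_map_iff mu_nat)

text \<open>The associativity axiom of a module, read as a commuting square. It connects every
  module to a free one, which is how a lift is later reduced to its values on free modules.\<close>

lemma is_module_map_structure:
  "is_module M T P \<Longrightarrow> is_module_map M T (Tob (fst P), mu T (fst P)) (snd P) P"
  by (simp add: is_module_iff is_module_map_iff)

end

section \<open>Right actions\<close>

context right_action
begin

lemma act_Ob [simp]: "X \<in> Ob M \<Longrightarrow> Q \<in> Ob C \<Longrightarrow> X \<lozenge>\<^bsub>A\<^esub> Q \<in> Ob M"
  by simp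

lemma tensor_Ob [simp]: "Q \<in> Ob C \<Longrightarrow> R \<in> Ob C \<Longrightarrow> Q \<otimes>\<^bsub>C\<^esub> R \<in> Ob C"
  by simp

lemma tensor_Ar [simp]:
  assumes "f \<in> Ar C" "g \<in> Ar C"
  shows "f \<otimes>\<^sub>m\<^bsub>C\<^esub> g \<in> Ar C" "Dom C (f \<otimes>\<^sub>m\<^bsub>C\<^esub> g) = Dom C f \<otimes>\<^bsub>C\<^esub> Dom C g"
    "Cod C (f \<otimes>\<^sub>m\<^bsub>C\<^esub> g) = Cod C f \<otimes>\<^bsub>C\<^esub> Cod C g"
  using assms by simp_all

lemma act_Ar [simp]:
  assumes "f \<in> Ar M" "g \<in> Ar C"
  shows "f \<lozenge>\<^sub>m\<^bsub>A\<^esub> g \<in> Ar M" "Dom M (f \<lozenge>\<^sub>m\<^bsub>A\<^esub> g) = Dom M f \<lozenge>\<^bsub>A\<^esub> Dom C g"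
    "Cod M (f \<lozenge>\<^sub>m\<^bsub>A\<^esub> g) = Cod M f \<lozenge>\<^bsub>A\<^esub> Cod C g"
  using assms by simp_all

lemma act_idm [simp]:
  "X \<in> Ob M \<Longrightarrow> Q \<in> Ob C \<Longrightarrow> idm M X \<lozenge>\<^sub>m\<^bsub>A\<^esub> idm C Q = idm M (X \<lozenge>\<^bsub>A\<^esub> Q)"
  using Act.amap_idm[of "(X, Q)"] by simp

lemma tensor_idm [simp]:
  "Q \<in> Ob C \<Longrightarrow> R \<in> Ob C \<Longrightarrow> idm C Q \<otimes>\<^sub>m\<^bsub>C\<^esub> idm C R = idm C (Q \<otimes>\<^bsub>C\<^esub> R)"
  using C.tensor.amap_idm[of "(Q, R)"] by simp

text \<open>The interchange law, oriented to merge two factors into one. Proofs that use it control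
  the bracketing by suspending or reversing \<open>comp_assoc_Ar\<close>.\<close>

lemma act_comp:
  assumes "f \<in> Ar M" "f' \<in> Ar M" "Cod M f = Dom M f'" "g \<in> Ar C" "g' \<in> Ar C" "Cod C g = Dom C g'"
  shows "(f' \<lozenge>\<^sub>m\<^bsub>A\<^esub> g') \<cdot>\<^bsub>M\<^esub> (f \<lozenge>\<^sub>m\<^bsub>A\<^esub> g) = (f' \<cdot>\<^bsub>M\<^esub> f) \<lozenge>\<^sub>m\<^bsub>A\<^esub> (g' \<cdot>\<^bsub>C\<^esub> g)"
  using Act.amap_comp_Ar[of "(f, g)" "(f', g')"] assms by simp

lemma Psi_Ar [simp]:
  assumes "X \<in> Ob M" "Q \<in> Ob C" "R \<in> Ob C"
  shows "Psi A (X, Q, R) \<in> Ar M" "Dom M (Psi A (X, Q, R)) = X \<lozenge>\<^bsub>A\<^esub> (Q \<otimes>\<^bsub>C\<^esub> R)"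
    "Cod M (Psi A (X, Q, R)) = (X \<lozenge>\<^bsub>A\<^esub> Q) \<lozenge>\<^bsub>A\<^esub> R"
  using Psi.component_Ar[of "(X, Q, R)"] assms by simp_all

lemma Psi_nat:
  "f \<in> Ar M \<Longrightarrow> g \<in> Ar C \<Longrightarrow> h \<in> Ar C \<Longrightarrow>
   Psi A (Cod M f, Cod C g, Cod C h) \<cdot>\<^bsub>M\<^esub> (f \<lozenge>\<^sub>m\<^bsub>A\<^esub> (g \<otimes>\<^sub>m\<^bsub>C\<^esub> h)) =
   ((f \<lozenge>\<^sub>m\<^bsub>A\<^esub> g) \<lozenge>\<^sub>m\<^bsub>A\<^esub> h) \<cdot>\<^bsub>M\<^esub> Psi A (Dom M f, Dom C g, Dom C h)"
  using Psi.naturality_Ar[of "(f, g, h)"] by simp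

lemma actu_Ar [simp]:
  assumes "X \<in> Ob M"
  shows "actu A X \<in> Ar M" "Dom M (actu A X) = X" "Cod M (actu A X) = X \<lozenge>\<^bsub>A\<^esub> \<one>\<^bsub>C\<^esub>"
  using u.component_Ar[OF assms] by (simp_all add: id_functor_def)

lemma actu_nat:
  "f \<in> Ar M \<Longrightarrow> actu A (Cod M f) \<cdot>\<^bsub>M\<^esub> f = (f \<lozenge>\<^sub>m\<^bsub>A\<^esub> idm C \<one>\<^bsub>C\<^esub>) \<cdot>\<^bsub>M\<^esub> actu A (Dom M f)"
  using u.naturality_Ar[of f] by (simp add: id_functor_def)

declare C.Unit_Ob [simp]

lemma assoc_Ar [simp]:
  assumes "X \<in> Ob C" "Q \<in> Ob C" "R \<in> Ob C"
  shows "assoc C (X, Q, R) \<in> Ar C" "Dom C (assoc C (X, Q, R)) = X \<otimes>\<^bsub>C\<^esub> (Q \<otimes>\<^bsub>C\<^esub> R)"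
    "Cod C (assoc C (X, Q, R)) = (X \<otimes>\<^bsub>C\<^esub> Q) \<otimes>\<^bsub>C\<^esub> R"
  using C.assoc.component_Ar[of "(X, Q, R)"] assms by simp_all

lemma runit_Ar [simp]:
  assumes "X \<in> Ob C"
  shows "runit C X \<in> Ar C" "Dom C (runit C X) = X" "Cod C (runit C X) = X \<otimes>\<^bsub>C\<^esub> \<one>\<^bsub>C\<^esub>"
  using C.runit.component_Ar[OF assms] by (simp_all add: id_functor_def)

lemma lunit_Ar [simp]:
  assumes "X \<in> Ob C"
  shows "lunit C X \<in> Ar C" "Dom C (lunit C X) = X" "Cod C (lunit C X) = \<one>\<^bsub>C\<^esub> \<otimes>\<^bsub>C\<^esub> X"
  using C.lunit.component_Ar[OF assms] by (simp_all add: id_functor_def)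

end


text \<open>The locale \<open>right_action\<close> also demands that the sources and targets of
  \<open>Psi\<close> and \<open>actu\<close> be functors. This follows from functoriality of
  \<open>Act B\<close> and of the tensor product, so only conditions on components remain for a
  concrete action.\<close>

lemma right_actionI:
  assumes "monoidal_category C" "category N" and Act: "is_functor (N \<times>\<^sub>c C) N (Act B)"
    and Psi: "\<And>X Q R. X \<in> Ob N \<Longrightarrow> Q \<in> Ob C \<Longrightarrow> R \<in> Ob C \<Longrightarrow>
      Psi B (X, Q, R) \<in> Hom N (X \<lozenge>\<^bsub>B\<^esub> (Q \<otimes>\<^bsub>C\<^esub> R)) ((X \<lozenge>\<^bsub>B\<^esub> Q) \<lozenge>\<^bsub>B\<^esub> R)"
    and Psi_nat: "\<And>f g h. f \<in> Ar N \<Longrightarrow> g \<in> Ar C \<Longrightarrow> h \<in> Ar C \<Longrightarrow>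
      Psi B (Cod N f, Cod C g, Cod C h) \<cdot>\<^bsub>N\<^esub> (f \<lozenge>\<^sub>m\<^bsub>B\<^esub> (g \<otimes>\<^sub>m\<^bsub>C\<^esub> h)) =
      ((f \<lozenge>\<^sub>m\<^bsub>B\<^esub> g) \<lozenge>\<^sub>m\<^bsub>B\<^esub> h) \<cdot>\<^bsub>N\<^esub> Psi B (Dom N f, Dom C g, Dom C h)"
    and u: "\<And>X. X \<in> Ob N \<Longrightarrow> actu B X \<in> Hom N X (X \<lozenge>\<^bsub>B\<^esub> \<one>\<^bsub>C\<^esub>) \<and> is_iso N (actu B X)"
    and u_nat: "\<And>f. f \<in> Ar N \<Longrightarrow>
      actu B (Cod N f) \<cdot>\<^bsub>N\<^esub> f = (f \<lozenge>\<^sub>m\<^bsub>B\<^esub> idm C \<one>\<^bsub>C\<^esub>) \<cdot>\<^bsub>N\<^esub> actu B (Dom N f)"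
    and coherence: "right_action_axioms C N B"
  shows "right_action C N B"
proof -
  interpret C: monoidal_category C by fact
  interpret N: category N by fact
  interpret A: is_functor "N \<times>\<^sub>c C" N "Act B" by fact
  have NCC: "category (N \<times>\<^sub>c C \<times>\<^sub>c C)"
    by (intro category_prod_cat N.category_axioms C.category_axioms)
  note [simp] = C.Unit_Ob
  have A_Ob [simp]: "X \<lozenge>\<^bsub>B\<^esub> Q \<in> Ob N" if "X \<in> Ob N" "Q \<in> Ob C" for X Q
    using that by simp
  have A_Ar [simp]: "f \<lozenge>\<^sub>m\<^bsub>B\<^esub> g \<in> Ar N" "Dom N (f \<lozenge>\<^sub>m\<^bsub>B\<^esub> g) = Dom N f \<lozenge>\<^bsub>B\<^esub> Dom C g"
    "Cod N (f \<lozenge>\<^sub>m\<^bsub>B\<^esub> g) = Cod N f \<lozenge>\<^bsub>B\<^esub> Cod C g" if "f \<in> Ar N" "g \<in> Ar C" for f g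
    using that by simp_all
  have A_idm [simp]: "idm N X \<lozenge>\<^sub>m\<^bsub>B\<^esub> idm C Q = idm N (X \<lozenge>\<^bsub>B\<^esub> Q)" if "X \<in> Ob N" "Q \<in> Ob C" for X Q
    using A.amap_idm[of "(X, Q)"] that by simp
  have t_idm [simp]: "idm C X \<otimes>\<^sub>m\<^bsub>C\<^esub> idm C Q = idm C (X \<otimes>\<^bsub>C\<^esub> Q)" if "X \<in> Ob C" "Q \<in> Ob C" for X Q
    using C.tensor.amap_idm[of "(X, Q)"] that by simp
  \<comment> \<open>Oriented to split, opposite to \<open>act_comp\<close>: the functor equations
    below become syntactic once every composite is pushed outwards.\<close>
  have A_comp: "(f' \<cdot>\<^bsub>N\<^esub> f) \<lozenge>\<^sub>m\<^bsub>B\<^esub> (g' \<cdot>\<^bsub>C\<^esub> g) = (f' \<lozenge>\<^sub>m\<^bsub>B\<^esub> g') \<cdot>\<^bsub>N\<^esub> (f \<lozenge>\<^sub>m\<^bsub>B\<^esub> g)"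
    if "f \<in> Ar N" "f' \<in> Ar N" "Cod N f = Dom N f'" "g \<in> Ar C" "g' \<in> Ar C" "Cod C g = Dom C g'"
    for f f' g g'
    using A.amap_comp_Ar[of "(f, g)" "(f', g')"] that by simp
  have t_comp: "(f' \<cdot>\<^bsub>C\<^esub> f) \<otimes>\<^sub>m\<^bsub>C\<^esub> (g' \<cdot>\<^bsub>C\<^esub> g) = (f' \<otimes>\<^sub>m\<^bsub>C\<^esub> g') \<cdot>\<^bsub>C\<^esub> (f \<otimes>\<^sub>m\<^bsub>C\<^esub> g)"
    if "f \<in> Ar C" "f' \<in> Ar C" "Cod C f = Dom C f'" "g \<in> Ar C" "g' \<in> Ar C" "Cod C g = Dom C g'"
    for f f' g g'
    using C.tensor.amap_comp_Ar[of "(f, g)" "(f', g')"] that by simp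
  \<comment> \<open>A single identity on the right is not a composite, so \<open>A_comp\<close> does
    not match; it is used here with the unit identity written as a composite of two copies of
    itself.\<close>
  have A_unit_comp: "(f' \<cdot>\<^bsub>N\<^esub> f) \<lozenge>\<^sub>m\<^bsub>B\<^esub> idm C \<one>\<^bsub>C\<^esub> = (f' \<lozenge>\<^sub>m\<^bsub>B\<^esub> idm C \<one>\<^bsub>C\<^esub>) \<cdot>\<^bsub>N\<^esub> (f \<lozenge>\<^sub>m\<^bsub>B\<^esub> idm C \<one>\<^bsub>C\<^esub>)"
    if "f \<in> Ar N" "f' \<in> Ar N" "Cod N f = Dom N f'" for f f'
    using A_comp[OF that, of "idm C \<one>\<^bsub>C\<^esub>" "idm C \<one>\<^bsub>C\<^esub>"] by simp
  show ?thesis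
  proof (intro right_action.intro nat_iso.intro nat_trans.intro nat_trans_axioms.intro nat_iso_axioms.intro)
    show "is_functor (N \<times>\<^sub>c C \<times>\<^sub>c C) N
      \<lparr>omap = (\<lambda>(X, Q, R). X \<lozenge>\<^bsub>B\<^esub> (Q \<otimes>\<^bsub>C\<^esub> R)), amap = (\<lambda>(f, g, h). f \<lozenge>\<^sub>m\<^bsub>B\<^esub> (g \<otimes>\<^sub>m\<^bsub>C\<^esub> h))\<rparr>"
      by (rule is_functorI) (auto simp: Hom_def NCC N.category_axioms A_comp t_comp)
    show "is_functor (N \<times>\<^sub>c C \<times>\<^sub>c C) N
      \<lparr>omap = (\<lambda>(X, Q, R). (X \<lozenge>\<^bsub>B\<^esub> Q) \<lozenge>\<^bsub>B\<^esub> R), amap = (\<lambda>(f, g, h). (f \<lozenge>\<^sub>m\<^bsub>B\<^esub> g) \<lozenge>\<^sub>m\<^bsub>B\<^esub> h)\<rparr>"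
      by (rule is_functorI) (auto simp: Hom_def NCC N.category_axioms A_comp)
    show "is_functor N N id_functor"
      by (rule is_functorI) (auto simp: Hom_def N.category_axioms id_functor_def)
    show "is_functor N N \<lparr>omap = (\<lambda>X. X \<lozenge>\<^bsub>B\<^esub> \<one>\<^bsub>C\<^esub>), amap = (\<lambda>f. f \<lozenge>\<^sub>m\<^bsub>B\<^esub> idm C \<one>\<^bsub>C\<^esub>)\<rparr>"
      by (rule is_functorI) (auto simp: Hom_def N.category_axioms A_unit_comp)
  qed (use assms Psi_nat u_nat in \<open>auto simp: id_functor_def Hom_def\<close>)
qed

section \<open>From distributive laws to lifts\<close>

context distributive_law
begin

lemma l_Ar [simp]:
  assumes "X \<in> Ob M" "Q \<in> Ob C"
  shows "l (X, Q) \<in> Ar M" "Dom M (l (X, Q)) = monad.Tob (X \<lozenge>\<^bsub>A\<^esub> Q)"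
    "Cod M (l (X, Q)) = monad.Tob X \<lozenge>\<^bsub>A\<^esub> Q"
  using l.component_Ar[of "(X, Q)"] assms by simp_all

lemma l_nat:
  assumes "f \<in> Ar M" "g \<in> Ar C"
  shows "l (Cod M f, Cod C g) \<cdot>\<^bsub>M\<^esub> monad.Tar (f \<lozenge>\<^sub>m\<^bsub>A\<^esub> g) =
    (monad.Tar f \<lozenge>\<^sub>m\<^bsub>A\<^esub> g) \<cdot>\<^bsub>M\<^esub> l (Dom M f, Dom C g)"
  using l.naturality_Ar[of "(f, g)"] assms by simp

abbreviation lift_ob where "lift_ob \<equiv> lift_ob_of C M A l"

lemma lift_ob_simps [simp]:
  "fst (lift_ob P Q) = fst P \<lozenge>\<^bsub>A\<^esub> Q"
  "snd (lift_ob P Q) = (snd P \<lozenge>\<^sub>m\<^bsub>A\<^esub> idm C Q) \<cdot>\<^bsub>M\<^esub> l (fst P, Q)"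
  by (simp_all add: lift_ob_of_def split: prod.split)

text \<open>Besides D1 and D3, the key is naturality of \<open>l\<close> at the structure map
  \<open>\<nu>\<close>, which brings the two copies of \<open>\<nu>\<close> together so that the
  module law of \<open>P\<close> applies.\<close>

lemma is_module_lift_ob [simp]:
  assumes P: "is_module M T P" and Q [simp]: "Q \<in> Ob C"
  shows "is_module M T (lift_ob P Q)"
proof -
  define X \<nu> where "X = fst P" and "\<nu> = snd P"
  have [simp]: "X \<in> Ob M" "\<nu> \<in> Ar M" "Dom M \<nu> = monad.Tob X" "Cod M \<nu> = X"
    and \<nu>: "\<nu> \<cdot>\<^bsub>M\<^esub> monad.Tar \<nu> = \<nu> \<cdot>\<^bsub>M\<^esub> mu T X" "\<nu> \<cdot>\<^bsub>M\<^esub> eta T X = idm M X"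
    using monad.is_moduleD[OF P] by (simp_all add: X_def \<nu>_def)
  let ?s = "(\<nu> \<lozenge>\<^sub>m\<^bsub>A\<^esub> idm C Q) \<cdot>\<^bsub>M\<^esub> l (X, Q)"
  have "?s \<cdot>\<^bsub>M\<^esub> monad.Tar ?s =
      (\<nu> \<lozenge>\<^sub>m\<^bsub>A\<^esub> idm C Q) \<cdot>\<^bsub>M\<^esub> (l (X, Q) \<cdot>\<^bsub>M\<^esub> monad.Tar (\<nu> \<lozenge>\<^sub>m\<^bsub>A\<^esub> idm C Q)) \<cdot>\<^bsub>M\<^esub> monad.Tar (l (X, Q))"
    by (simp add: monad.T.amap_comp_Ar)
  also have "\<dots> = ((\<nu> \<lozenge>\<^sub>m\<^bsub>A\<^esub> idm C Q) \<cdot>\<^bsub>M\<^esub> (monad.Tar \<nu> \<lozenge>\<^sub>m\<^bsub>A\<^esub> idm C Q)) \<cdot>\<^bsub>M\<^esub> l (monad.Tob X, Q) \<cdot>\<^bsub>M\<^esub> monad.Tar (l (X, Q))"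
    using l_nat[of \<nu> "idm C Q"] by simp
  \<comment> \<open>The module law trades \<open>T(\<nu>)\<close> for \<open>\<mu>\<close>.
    Reassociation is switched off so that the two adjacent factors stay bracketed for
    \<open>act_comp\<close>.\<close>
  also have "\<dots> = ((\<nu> \<lozenge>\<^sub>m\<^bsub>A\<^esub> idm C Q) \<cdot>\<^bsub>M\<^esub> (mu T X \<lozenge>\<^sub>m\<^bsub>A\<^esub> idm C Q)) \<cdot>\<^bsub>M\<^esub> l (monad.Tob X, Q) \<cdot>\<^bsub>M\<^esub> monad.Tar (l (X, Q))"
    by (simp add: act.act_comp \<nu> del: act.M.comp_assoc_Ar)
  also have "\<dots> = (\<nu> \<lozenge>\<^sub>m\<^bsub>A\<^esub> idm C Q) \<cdot>\<^bsub>M\<^esub> (mu T X \<lozenge>\<^sub>m\<^bsub>A\<^esub> idm C Q) \<cdot>\<^bsub>M\<^esub> l (monad.Tob X, Q) \<cdot>\<^bsub>M\<^esub> monad.Tar (l (X, Q))"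
    by simp
  also have "\<dots> = ?s \<cdot>\<^bsub>M\<^esub> mu T (X \<lozenge>\<^bsub>A\<^esub> Q)"
    by (simp add: D1)
  finally have 1: "?s \<cdot>\<^bsub>M\<^esub> monad.Tar ?s = ?s \<cdot>\<^bsub>M\<^esub> mu T (X \<lozenge>\<^bsub>A\<^esub> Q)" .
  have "?s \<cdot>\<^bsub>M\<^esub> eta T (X \<lozenge>\<^bsub>A\<^esub> Q) = idm M (X \<lozenge>\<^bsub>A\<^esub> Q)"
    by (simp add: D3 act.act_comp \<nu>)
  with 1 show ?thesis by (simp add: monad.is_module_iff flip: X_def \<nu>_def)
qed

text \<open>Naturality of \<open>l\<close> in both variables moves \<open>f\<close> and
  \<open>g\<close> to the left of it; then the square of \<open>f\<close> applies in the first
  argument, while the identities at the two ends of \<open>g\<close> are absorbed.\<close>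

lemma is_module_map_lift:
  assumes P: "is_module M T P" and R: "is_module M T R" and f: "is_module_map M T P f R"
    and g [simp]: "g \<in> Ar C"
  shows "is_module_map M T (lift_ob P (Dom C g)) (f \<lozenge>\<^sub>m\<^bsub>A\<^esub> g) (lift_ob R (Cod C g))"
proof -
  note [simp] = monad.is_moduleD(1-4)[OF P] monad.is_moduleD(1-4)[OF R] monad.is_module_mapD(1-3)[OF f]
  have "((snd R \<lozenge>\<^sub>m\<^bsub>A\<^esub> idm C (Cod C g)) \<cdot>\<^bsub>M\<^esub> l (fst R, Cod C g)) \<cdot>\<^bsub>M\<^esub> monad.Tar (f \<lozenge>\<^sub>m\<^bsub>A\<^esub> g) =
    (snd R \<lozenge>\<^sub>m\<^bsub>A\<^esub> idm C (Cod C g)) \<cdot>\<^bsub>M\<^esub> (monad.Tar f \<lozenge>\<^sub>m\<^bsub>A\<^esub> g) \<cdot>\<^bsub>M\<^esub> l (fst P, Dom C g)"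
    using l_nat[of f g] by simp
  also have "\<dots> = ((snd R \<cdot>\<^bsub>M\<^esub> monad.Tar f) \<lozenge>\<^sub>m\<^bsub>A\<^esub> g) \<cdot>\<^bsub>M\<^esub> l (fst P, Dom C g)"
    by (simp add: act.act_comp flip: act.M.comp_assoc_Ar)
  also have "\<dots> = ((f \<lozenge>\<^sub>m\<^bsub>A\<^esub> g) \<cdot>\<^bsub>M\<^esub> (snd P \<lozenge>\<^sub>m\<^bsub>A\<^esub> idm C (Dom C g))) \<cdot>\<^bsub>M\<^esub> l (fst P, Dom C g)"
    by (simp add: act.act_comp monad.is_module_mapD(4)[OF f] del: act.M.comp_assoc_Ar)
  finally show ?thesis by (simp add: monad.is_module_map_iff)
qed

text \<open>D2 carries \<open>Psi\<close> across \<open>l\<close>, and naturality of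
  \<open>Psi\<close> at \<open>\<nu>\<close> carries it across the structure map.\<close>

lemma is_module_map_Psi:
  assumes P: "is_module M T P" and QR [simp]: "Q \<in> Ob C" "R \<in> Ob C"
  shows "is_module_map M T (lift_ob P (Q \<otimes>\<^bsub>C\<^esub> R)) (Psi A (fst P, Q, R)) (lift_ob (lift_ob P Q) R)"
proof -
  define X \<nu> where "X = fst P" and "\<nu> = snd P"
  have [simp]: "X \<in> Ob M" "\<nu> \<in> Ar M" "Dom M \<nu> = monad.Tob X" "Cod M \<nu> = X"
    using monad.is_moduleD[OF P] by (simp_all add: X_def \<nu>_def)
  let ?\<Psi> = "Psi A (X, Q, R)"
  have split: "((\<nu> \<lozenge>\<^sub>m\<^bsub>A\<^esub> idm C Q) \<cdot>\<^bsub>M\<^esub> l (X, Q)) \<lozenge>\<^sub>m\<^bsub>A\<^esub> idm C R =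
    ((\<nu> \<lozenge>\<^sub>m\<^bsub>A\<^esub> idm C Q) \<lozenge>\<^sub>m\<^bsub>A\<^esub> idm C R) \<cdot>\<^bsub>M\<^esub> (l (X, Q) \<lozenge>\<^sub>m\<^bsub>A\<^esub> idm C R)"
    by (simp add: act.act_comp)
  have "((((\<nu> \<lozenge>\<^sub>m\<^bsub>A\<^esub> idm C Q) \<cdot>\<^bsub>M\<^esub> l (X, Q)) \<lozenge>\<^sub>m\<^bsub>A\<^esub> idm C R) \<cdot>\<^bsub>M\<^esub> l (X \<lozenge>\<^bsub>A\<^esub> Q, R)) \<cdot>\<^bsub>M\<^esub> monad.Tar ?\<Psi> =
    ((\<nu> \<lozenge>\<^sub>m\<^bsub>A\<^esub> idm C Q) \<lozenge>\<^sub>m\<^bsub>A\<^esub> idm C R) \<cdot>\<^bsub>M\<^esub> (l (X, Q) \<lozenge>\<^sub>m\<^bsub>A\<^esub> idm C R) \<cdot>\<^bsub>M\<^esub> l (X \<lozenge>\<^bsub>A\<^esub> Q, R) \<cdot>\<^bsub>M\<^esub> monad.Tar ?\<Psi>"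
    by (simp add: split)
  also have "\<dots> = (((\<nu> \<lozenge>\<^sub>m\<^bsub>A\<^esub> idm C Q) \<lozenge>\<^sub>m\<^bsub>A\<^esub> idm C R) \<cdot>\<^bsub>M\<^esub> Psi A (monad.Tob X, Q, R)) \<cdot>\<^bsub>M\<^esub> l (X, Q \<otimes>\<^bsub>C\<^esub> R)"
    by (simp flip: D2)
  \<comment> \<open>The tensor of the identities must stay unmerged to match naturality of
    \<open>Psi\<close>; the final simplification turns it into the identity of the tensor
    product.\<close>
  also have "\<dots> = (?\<Psi> \<cdot>\<^bsub>M\<^esub> (\<nu> \<lozenge>\<^sub>m\<^bsub>A\<^esub> (idm C Q \<otimes>\<^sub>m\<^bsub>C\<^esub> idm C R))) \<cdot>\<^bsub>M\<^esub> l (X, Q \<otimes>\<^bsub>C\<^esub> R)"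
    using act.Psi_nat[of \<nu> "idm C Q" "idm C R"] by (simp del: act.tensor_idm)
  finally show ?thesis
    by (simp add: monad.is_module_map_iff flip: X_def \<nu>_def)
qed

text \<open>Naturality of \<open>u\<close> at the structure map, with \<open>u\<close> at
  \<open>T X\<close> rewritten by D4.\<close>

lemma is_module_map_actu:
  assumes P: "is_module M T P"
  shows "is_module_map M T P (actu A (fst P)) (lift_ob P \<one>\<^bsub>C\<^esub>)"
  using monad.is_moduleD[OF P] act.actu_nat[of "snd P"]
  by (simp add: monad.is_module_map_iff D4)

text \<open>Naturality of \<open>l\<close> at the unit \<open>\<eta>\<close> leaves
  \<open>\<mu>\<close> composed with \<open>T(\<eta>)\<close>, which is an identity. Hence a law can
  be read off from its lift, which yields injectivity.\<close>

lemma lift_free_module: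
  assumes [simp]: "X \<in> Ob M" "Q \<in> Ob C"
  shows "snd (lift_ob (monad.Tob X, mu T X) Q) \<cdot>\<^bsub>M\<^esub> monad.Tar (eta T X \<lozenge>\<^sub>m\<^bsub>A\<^esub> idm C Q) = l (X, Q)"
proof -
  have "snd (lift_ob (monad.Tob X, mu T X) Q) \<cdot>\<^bsub>M\<^esub> monad.Tar (eta T X \<lozenge>\<^sub>m\<^bsub>A\<^esub> idm C Q) =
    (mu T X \<lozenge>\<^sub>m\<^bsub>A\<^esub> idm C Q) \<cdot>\<^bsub>M\<^esub> (monad.Tar (eta T X) \<lozenge>\<^sub>m\<^bsub>A\<^esub> idm C Q) \<cdot>\<^bsub>M\<^esub> l (X, Q)"
    using l_nat[of "eta T X" "idm C Q"] by simp
  also have "\<dots> = l (X, Q)"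
    by (simp add: act.act_comp monad.mu_eta_right flip: act.M.comp_assoc_Ar)
  finally show ?thesis .
qed


section \<open>The induced action on the Eilenberg-Moore category\<close>

abbreviation lift where "lift \<equiv> lift_of C M A T l"

text \<open>\<open>lift_of\<close> consists of restricted functions, so it can be evaluated only
  after membership in the Eilenberg-Moore category is known. This is why the module map lemmas recur
  in the simplifications below.\<close>

lemma lift_simps:
  "is_module M T P \<Longrightarrow> Q \<in> Ob C \<Longrightarrow> P \<lozenge>\<^bsub>lift\<^esub> Q = lift_ob P Q"
  "(P, f, R) \<in> Ar (EM M T) \<Longrightarrow> g \<in> Ar C \<Longrightarrow>
    (P, f, R) \<lozenge>\<^sub>m\<^bsub>lift\<^esub> g = (lift_ob P (Dom C g), f \<lozenge>\<^sub>m\<^bsub>A\<^esub> g, lift_ob R (Cod C g))"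
  "is_module M T P \<Longrightarrow> Q \<in> Ob C \<Longrightarrow> S \<in> Ob C \<Longrightarrow>
    Psi lift (P, Q, S) = (lift_ob P (Q \<otimes>\<^bsub>C\<^esub> S), Psi A (fst P, Q, S), lift_ob (lift_ob P Q) S)"
  "is_module M T P \<Longrightarrow> actu lift P = (P, actu A (fst P), lift_ob P \<one>\<^bsub>C\<^esub>)"
  by (simp_all add: lift_of_def Let_def)

lemma extensional_lift: "extensional_action C (EM M T) lift"
  by (simp add: extensional_action_def lift_of_def Let_def)

text \<open>The forgetful functor reflects isomorphisms: conjugating the square of \<open>f\<close>
  with the inverse arrow gives the square of the inverse. Needed for the components of the lifted
  \<open>u\<close>.\<close>

lemma is_iso_EM:
  assumes P: "is_module M T P" and R: "is_module M T R" and f: "is_module_map M T P f R"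
    and iso: "is_iso M f"
  shows "is_iso (EM M T) (P, f, R)"
proof -
  note [simp] = monad.is_moduleD(1-4)[OF P] monad.is_moduleD(1-4)[OF R] monad.is_module_mapD(1-3)[OF f]
  obtain g where [simp]: "g \<in> Ar M" "Dom M g = fst R" "Cod M g = fst P"
    and g: "g \<cdot>\<^bsub>M\<^esub> f = idm M (fst P)" "f \<cdot>\<^bsub>M\<^esub> g = idm M (fst R)"
    using iso by (auto simp: is_iso_def Hom_def)
  \<comment> \<open>An identity in the form of \<open>g\<close> after \<open>f\<close> is inserted
    in front, so that the square of \<open>f\<close> can be used and \<open>f\<close> meets
    \<open>g\<close> under \<open>T\<close>.\<close>
  have "snd P \<cdot>\<^bsub>M\<^esub> monad.Tar g = ((g \<cdot>\<^bsub>M\<^esub> f) \<cdot>\<^bsub>M\<^esub> snd P) \<cdot>\<^bsub>M\<^esub> monad.Tar g"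
    unfolding g by simp
  also have "\<dots> = (g \<cdot>\<^bsub>M\<^esub> (f \<cdot>\<^bsub>M\<^esub> snd P)) \<cdot>\<^bsub>M\<^esub> monad.Tar g"
    by simp
  also have "\<dots> = g \<cdot>\<^bsub>M\<^esub> snd R \<cdot>\<^bsub>M\<^esub> monad.Tar (f \<cdot>\<^bsub>M\<^esub> g)"
    unfolding monad.is_module_mapD(4)[OF f, symmetric] by (simp add: monad.T.amap_comp_Ar)
  also have "\<dots> = g \<cdot>\<^bsub>M\<^esub> snd R"
    unfolding g by simp
  finally have "is_module_map M T R g P"
    by (simp add: monad.is_module_map_iff)
  then show ?thesis
    unfolding is_iso_def using P R f g
    by (intro conjI bexI[of _ "(R, g, P)"]) (simp_all add: Hom_def)
qed

text \<open>Each equation of triples splits into agreement of the endpoint modules, which holds by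
  construction, and the corresponding equation for \<open>A\<close>.\<close>

lemma right_action_lift: "right_action C (EM M T) lift"
proof (rule right_actionI)
  note EM_cat = monad.category_EM
  show "is_functor (EM M T \<times>\<^sub>c C) (EM M T) (Act lift)"
  proof (rule is_functorI)
    show "category (EM M T \<times>\<^sub>c C)" "category (EM M T)"
      by (intro category_prod_cat EM_cat act.C.category_axioms)+
  next
    fix x assume "x \<in> Ar (EM M T \<times>\<^sub>c C)"
    then show "amap (Act lift) x \<in> Hom (EM M T) (omap (Act lift) (Dom (EM M T \<times>\<^sub>c C) x))
      (omap (Act lift) (Cod (EM M T \<times>\<^sub>c C) x))"
      by (cases x) (auto simp: Hom_def lift_simps intro: is_module_map_lift)
  next
    fix x assume "x \<in> Ob (EM M T \<times>\<^sub>c C)"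
    then obtain P Q where "x = (P, Q)" "is_module M T P" "Q \<in> Ob C"
      by (cases x) auto
    then show "amap (Act lift) (idm (EM M T \<times>\<^sub>c C) x) = idm (EM M T) (omap (Act lift) x)"
      by (simp add: lift_simps monad.is_module_map_idm monad.is_moduleD(1))
  next
    fix x y assume "x \<in> Ar (EM M T \<times>\<^sub>c C)" "y \<in> Ar (EM M T \<times>\<^sub>c C)"
      "Cod (EM M T \<times>\<^sub>c C) x = Dom (EM M T \<times>\<^sub>c C) y"
    then obtain P R S f f' g g' where xy: "x = ((P, f, R), g)" "y = ((R, f', S), g')"
      and P: "is_module M T P" "is_module M T R" "is_module M T S"
      and f: "is_module_map M T P f R" "is_module_map M T R f' S"
      and g: "g \<in> Ar C" "g' \<in> Ar C" "Cod C g = Dom C g'"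
      by (cases x; cases y) auto
    show "amap (Act lift) (y \<cdot>\<^bsub>EM M T \<times>\<^sub>c C\<^esub> x) = amap (Act lift) y \<cdot>\<^bsub>EM M T\<^esub> amap (Act lift) x"
      \<comment> \<open>The composite must be known to be a module map before the lifted functor can
        be evaluated at it.\<close>
      using P f g monad.is_module_map_comp[OF P f] monad.is_module_mapD(1-3)[OF f(1)]
        monad.is_module_mapD(1-3)[OF f(2)]
      by (simp add: xy lift_simps act.act_comp)
  qed (auto simp: lift_simps)
  show "right_action_axioms C (EM M T) lift"
  proof
    fix P Q R S assume "P \<in> Ob (EM M T)" "Q \<in> Ob C" "R \<in> Ob C" "S \<in> Ob C"
    then show "Psi lift (P \<lozenge>\<^bsub>lift\<^esub> Q, R, S) \<cdot>\<^bsub>EM M T\<^esub> Psi lift (P, Q, R \<otimes>\<^bsub>C\<^esub> S) =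
      (Psi lift (P, Q, R) \<lozenge>\<^sub>m\<^bsub>lift\<^esub> idm C S) \<cdot>\<^bsub>EM M T\<^esub> Psi lift (P, Q \<otimes>\<^bsub>C\<^esub> R, S)
        \<cdot>\<^bsub>EM M T\<^esub> (idm (EM M T) P \<lozenge>\<^sub>m\<^bsub>lift\<^esub> assoc C (Q, R, S))"
      using act.act_assoc[of "fst P" Q R S]
      by (simp add: lift_simps is_module_map_Psi monad.is_module_map_idm monad.is_moduleD(1))
  next
    fix P Q assume "P \<in> Ob (EM M T)" "Q \<in> Ob C"
    then show "actu lift P \<lozenge>\<^sub>m\<^bsub>lift\<^esub> idm C Q =
      Psi lift (P, \<one>\<^bsub>C\<^esub>, Q) \<cdot>\<^bsub>EM M T\<^esub> (idm (EM M T) P \<lozenge>\<^sub>m\<^bsub>lift\<^esub> lunit C Q)"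
      using act.act_lunit[of "fst P" Q]
      by (simp add: lift_simps is_module_map_actu monad.is_module_map_idm monad.is_moduleD(1))
  next
    fix P Q assume "P \<in> Ob (EM M T)" "Q \<in> Ob C"
    then show "actu lift (P \<lozenge>\<^bsub>lift\<^esub> Q) =
      Psi lift (P, Q, \<one>\<^bsub>C\<^esub>) \<cdot>\<^bsub>EM M T\<^esub> (idm (EM M T) P \<lozenge>\<^sub>m\<^bsub>lift\<^esub> runit C Q)"
      using act.act_runit[of "fst P" Q]
      by (simp add: lift_simps monad.is_module_map_idm monad.is_moduleD(1))
  qed
next
  fix t g h assume "t \<in> Ar (EM M T)" "g \<in> Ar C" "h \<in> Ar C"
  moreover obtain P f R where "t = (P, f, R)" by (cases t)
  ultimately show "Psi lift (Cod (EM M T) t, Cod C g, Cod C h) \<cdot>\<^bsub>EM M T\<^esub> (t \<lozenge>\<^sub>m\<^bsub>lift\<^esub> (g \<otimes>\<^sub>m\<^bsub>C\<^esub> h)) =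
      ((t \<lozenge>\<^sub>m\<^bsub>lift\<^esub> g) \<lozenge>\<^sub>m\<^bsub>lift\<^esub> h) \<cdot>\<^bsub>EM M T\<^esub> Psi lift (Dom (EM M T) t, Dom C g, Dom C h)"
    using act.Psi_nat[of f g h] monad.is_module_mapD(1-3)[of P f R]
    by (simp add: lift_simps is_module_map_lift)
next
  fix t assume "t \<in> Ar (EM M T)"
  moreover obtain P f R where "t = (P, f, R)" by (cases t)
  ultimately show "actu lift (Cod (EM M T) t) \<cdot>\<^bsub>EM M T\<^esub> t =
      (t \<lozenge>\<^sub>m\<^bsub>lift\<^esub> idm C \<one>\<^bsub>C\<^esub>) \<cdot>\<^bsub>EM M T\<^esub> actu lift (Dom (EM M T) t)"
    using act.actu_nat[of f] monad.is_module_mapD(1-3)[of P f R]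
    by (simp add: lift_simps)
next
  fix P assume "P \<in> Ob (EM M T)"
  then show "actu lift P \<in> Hom (EM M T) P (P \<lozenge>\<^bsub>lift\<^esub> \<one>\<^bsub>C\<^esub>) \<and> is_iso (EM M T) (actu lift P)"
    by (simp add: lift_simps Hom_def is_module_map_actu is_iso_EM monad.is_moduleD(1) act.u.component_iso)
next
  fix P Q R assume "P \<in> Ob (EM M T)" "Q \<in> Ob C" "R \<in> Ob C"
  then show "Psi lift (P, Q, R) \<in> Hom (EM M T) (P \<lozenge>\<^bsub>lift\<^esub> (Q \<otimes>\<^bsub>C\<^esub> R)) ((P \<lozenge>\<^bsub>lift\<^esub> Q) \<lozenge>\<^bsub>lift\<^esub> R)"
    by (simp add: lift_simps Hom_def is_module_map_Psi)
qed (rule act.C.monoidal_category_axioms monad.category_EM)+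

lemma strict_lift_lift: "strict_lift C (EM M T) M forgetful A lift"
  by (intro strict_lift.intro strict_lift_axioms.intro right_action_lift act.right_action_axioms
      monad.is_functor_forgetful)
    (auto simp: lift_simps)

end

section \<open>From lifts to distributive laws\<close>

text \<open>An arbitrary strict lift \<open>B\<close>. Its values outside the categories are left
  open; extensionality enters only in \<open>lift_of_law\<close>.\<close>

locale em_lift =
  strict_lift C "EM M T" M forgetful A B + monad: monad_on M T
  for C :: "('c, 'd, 'x) moncat_scheme" and M :: "('o, 'm, 'y) cat_scheme"
    and A :: "('o, 'm, 'c, 'd) action" and T :: "('o, 'm) monad"
    and B :: "(('o, 'm) em_ob, ('o, 'm) em_ar, 'c, 'd) action"
begin

text \<open>Strictness forces the underlying object of a lifted module, so this structure map is the
  only unknown in the object part of \<open>B\<close>.\<close>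

definition struct :: "('o, 'm) em_ob \<Rightarrow> 'c \<Rightarrow> 'm" where
  "struct P Q = snd (P \<lozenge>\<^bsub>B\<^esub> Q)"

abbreviation free :: "'o \<Rightarrow> ('o, 'm) em_ob" where
  "free X \<equiv> (monad.Tob X, mu T X)"

text \<open>The restriction makes it the representative that \<open>distributive_laws\<close>
  admits.\<close>

definition law :: "'o \<times> 'c \<Rightarrow> 'm" where
  "law = (\<lambda>(X, Q) \<in> Ob M \<times> Ob C. struct (free X) Q \<cdot>\<^bsub>M\<^esub> monad.Tar (eta T X \<lozenge>\<^sub>m\<^bsub>A\<^esub> idm C Q))"

lemma B_ob: "is_module M T P \<Longrightarrow> Q \<in> Ob C \<Longrightarrow> P \<lozenge>\<^bsub>B\<^esub> Q = (fst P \<lozenge>\<^bsub>A\<^esub> Q, struct P Q)"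
  using lift_ob[of P Q] by (simp add: prod_eq_iff struct_def)

lemma is_module_B: "is_module M T P \<Longrightarrow> Q \<in> Ob C \<Longrightarrow> is_module M T (P \<lozenge>\<^bsub>B\<^esub> Q)"
  using lifted.Act.omap_Ob[of "(P, Q)"] by simp

lemma struct_Ar [simp]:
  assumes "is_module M T P" "Q \<in> Ob C"
  shows "struct P Q \<in> Ar M" "Dom M (struct P Q) = monad.Tob (fst P \<lozenge>\<^bsub>A\<^esub> Q)"
    "Cod M (struct P Q) = fst P \<lozenge>\<^bsub>A\<^esub> Q"
  using monad.is_moduleD[OF is_module_B[OF assms]] by (simp_all add: B_ob assms)

lemma struct_assoc:
  assumes "is_module M T P" "Q \<in> Ob C"
  shows "struct P Q \<cdot>\<^bsub>M\<^esub> monad.Tar (struct P Q) = struct P Q \<cdot>\<^bsub>M\<^esub> mu T (fst P \<lozenge>\<^bsub>A\<^esub> Q)"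
    "struct P Q \<cdot>\<^bsub>M\<^esub> eta T (fst P \<lozenge>\<^bsub>A\<^esub> Q) = idm M (fst P \<lozenge>\<^bsub>A\<^esub> Q)"
  using monad.is_moduleD[OF is_module_B[OF assms]] by (simp_all add: B_ob assms)

text \<open>Strictness fixes the middle entry of the triple and functoriality of \<open>B\<close>
  the outer ones. The same holds for \<open>Psi B\<close> and \<open>actu B\<close>, so only
  \<open>struct\<close> remains free.\<close>

lemma B_ar:
  assumes "(P, f, R) \<in> Ar (EM M T)" "g \<in> Ar C"
  shows "(P, f, R) \<lozenge>\<^sub>m\<^bsub>B\<^esub> g = (P \<lozenge>\<^bsub>B\<^esub> Dom C g, f \<lozenge>\<^sub>m\<^bsub>A\<^esub> g, R \<lozenge>\<^bsub>B\<^esub> Cod C g)"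
  using lift_ar[OF assms] lifted.act_Ar(2,3)[OF assms] by (simp add: prod_eq_iff)

text \<open>This is the condition for the lifted pair to be an arrow of \<open>EM M T\<close>. It is
  the source of every naturality property of \<open>law\<close>.\<close>

lemma struct_nat:
  assumes P: "is_module M T P" "is_module M T R" and f: "is_module_map M T P f R" and g: "g \<in> Ar C"
  shows "struct R (Cod C g) \<cdot>\<^bsub>M\<^esub> monad.Tar (f \<lozenge>\<^sub>m\<^bsub>A\<^esub> g) = (f \<lozenge>\<^sub>m\<^bsub>A\<^esub> g) \<cdot>\<^bsub>M\<^esub> struct P (Dom C g)"
proof -
  have a: "(P, f, R) \<in> Ar (EM M T)" using P f by simp
  show ?thesis
    using lifted.act_Ar(1)[OF a g] P g unfolding B_ar[OF a g]
    by (simp add: B_ob monad.is_module_map_iff)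
qed

lemma B_Psi:
  assumes "is_module M T P" "Q \<in> Ob C" "R \<in> Ob C"
  shows "Psi B (P, Q, R) = (P \<lozenge>\<^bsub>B\<^esub> (Q \<otimes>\<^bsub>C\<^esub> R), Psi A (fst P, Q, R), (P \<lozenge>\<^bsub>B\<^esub> Q) \<lozenge>\<^bsub>B\<^esub> R)"
  using lift_Psi[of P Q R] lifted.Psi_Ar(2,3)[of P Q R] assms by (simp add: prod_eq_iff)

lemma B_actu:
  assumes "is_module M T P"
  shows "actu B P = (P, actu A (fst P), P \<lozenge>\<^bsub>B\<^esub> \<one>\<^bsub>C\<^esub>)"
  using lift_u[of P] lifted.actu_Ar(2,3)[of P] assms by (simp add: prod_eq_iff)

lemma struct_Psi:
  assumes "is_module M T P" "Q \<in> Ob C" "R \<in> Ob C"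
  shows "struct (P \<lozenge>\<^bsub>B\<^esub> Q) R \<cdot>\<^bsub>M\<^esub> monad.Tar (Psi A (fst P, Q, R)) =
    Psi A (fst P, Q, R) \<cdot>\<^bsub>M\<^esub> struct P (Q \<otimes>\<^bsub>C\<^esub> R)"
  using lifted.Psi_Ar(1)[of P Q R] assms is_module_B[of P Q] unfolding B_Psi[OF assms]
  by (simp add: monad.is_module_map_iff struct_def)

lemma struct_actu:
  assumes "is_module M T P"
  shows "struct P \<one>\<^bsub>C\<^esub> \<cdot>\<^bsub>M\<^esub> monad.Tar (actu A (fst P)) = actu A (fst P) \<cdot>\<^bsub>M\<^esub> snd P"
  using lifted.actu_Ar(1)[of P] assms unfolding B_actu[OF assms]
  by (simp add: monad.is_module_map_iff struct_def)

section \<open>The distributive law extracted from a lift\<close>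

lemma law_eq: "X \<in> Ob M \<Longrightarrow> Q \<in> Ob C \<Longrightarrow>
    law (X, Q) = struct (free X) Q \<cdot>\<^bsub>M\<^esub> monad.Tar (eta T X \<lozenge>\<^sub>m\<^bsub>A\<^esub> idm C Q)"
  by (simp add: law_def)

declare monad.is_module_free [simp]

lemma law_Ar [simp]:
  assumes "X \<in> Ob M" "Q \<in> Ob C"
  shows "law (X, Q) \<in> Ar M" "Dom M (law (X, Q)) = monad.Tob (X \<lozenge>\<^bsub>A\<^esub> Q)"
    "Cod M (law (X, Q)) = monad.Tob X \<lozenge>\<^bsub>A\<^esub> Q"
  using assms by (simp_all add: law_eq)

text \<open>The structure map \<open>\<nu>\<close> is itself a module map from the free module on \<open>X\<close> to \<open>(X, \<nu>)\<close>,
  so the lift is determined by its values on free modules.\<close>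

lemma struct_eq_law:
  assumes P: "is_module M T P" and Q [simp]: "Q \<in> Ob C"
  shows "struct P Q = (snd P \<lozenge>\<^sub>m\<^bsub>A\<^esub> idm C Q) \<cdot>\<^bsub>M\<^esub> law (fst P, Q)"
proof -
  note [simp] = P monad.is_moduleD(1-4)[OF P]
  have "(snd P \<lozenge>\<^sub>m\<^bsub>A\<^esub> idm C Q) \<cdot>\<^bsub>M\<^esub> law (fst P, Q) =
    ((snd P \<lozenge>\<^sub>m\<^bsub>A\<^esub> idm C Q) \<cdot>\<^bsub>M\<^esub> struct (free (fst P)) Q) \<cdot>\<^bsub>M\<^esub> monad.Tar (eta T (fst P) \<lozenge>\<^sub>m\<^bsub>A\<^esub> idm C Q)"
    by (simp add: law_eq)
  also have "\<dots> = struct P Q \<cdot>\<^bsub>M\<^esub> monad.Tar ((snd P \<lozenge>\<^sub>m\<^bsub>A\<^esub> idm C Q) \<cdot>\<^bsub>M\<^esub> (eta T (fst P) \<lozenge>\<^sub>m\<^bsub>A\<^esub> idm C Q))"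
    using struct_nat[OF _ P monad.is_module_map_structure[OF P], of "idm C Q"]
    by (simp add: monad.T.amap_comp_Ar flip: base.M.comp_assoc_Ar)
  also have "\<dots> = struct P Q"
    by (simp add: base.act_comp monad.is_moduleD(6))
  finally show ?thesis by simp
qed

text \<open>Two naturalities combine: that of \<open>\<eta>\<close> at \<open>f\<close>, and
  \<open>struct_nat\<close> for \<open>T f\<close> as a map of free modules.\<close>

lemma law_nat:
  assumes [simp]: "f \<in> Ar M" "g \<in> Ar C"
  shows "law (Cod M f, Cod C g) \<cdot>\<^bsub>M\<^esub> monad.Tar (f \<lozenge>\<^sub>m\<^bsub>A\<^esub> g) =
    (monad.Tar f \<lozenge>\<^sub>m\<^bsub>A\<^esub> g) \<cdot>\<^bsub>M\<^esub> law (Dom M f, Dom C g)"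
proof -
  let ?X = "Dom M f" and ?Y = "Cod M f"
  have "law (?Y, Cod C g) \<cdot>\<^bsub>M\<^esub> monad.Tar (f \<lozenge>\<^sub>m\<^bsub>A\<^esub> g) =
    struct (free ?Y) (Cod C g) \<cdot>\<^bsub>M\<^esub> monad.Tar ((eta T ?Y \<cdot>\<^bsub>M\<^esub> f) \<lozenge>\<^sub>m\<^bsub>A\<^esub> g)"
    by (simp add: law_eq base.act_comp flip: monad.T.amap_comp_Ar)
  also have "\<dots> = struct (free ?Y) (Cod C g) \<cdot>\<^bsub>M\<^esub>
      monad.Tar ((monad.Tar f \<lozenge>\<^sub>m\<^bsub>A\<^esub> g) \<cdot>\<^bsub>M\<^esub> (eta T ?X \<lozenge>\<^sub>m\<^bsub>A\<^esub> idm C (Dom C g)))"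
    by (simp add: base.act_comp monad.eta_nat)
  also have "\<dots> = (struct (free ?Y) (Cod C g) \<cdot>\<^bsub>M\<^esub> monad.Tar (monad.Tar f \<lozenge>\<^sub>m\<^bsub>A\<^esub> g)) \<cdot>\<^bsub>M\<^esub>
      monad.Tar (eta T ?X \<lozenge>\<^sub>m\<^bsub>A\<^esub> idm C (Dom C g))"
    by (simp add: monad.T.amap_comp_Ar)
  also have "\<dots> = (monad.Tar f \<lozenge>\<^sub>m\<^bsub>A\<^esub> g) \<cdot>\<^bsub>M\<^esub> law (?X, Dom C g)"
    using struct_nat[OF _ _ monad.is_module_map_free[of f], of g] by (simp add: law_eq)
  finally show ?thesis .
qed

text \<open>Associativity of the lifted structure map on the free module, together with naturality
  of \<open>\<mu>\<close> at the lifted unit \<open>?h\<close>.\<close>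

lemma law_D1:
  assumes [simp]: "X \<in> Ob M" "Q \<in> Ob C"
  shows "(mu T X \<lozenge>\<^sub>m\<^bsub>A\<^esub> idm C Q) \<cdot>\<^bsub>M\<^esub> law (monad.Tob X, Q) \<cdot>\<^bsub>M\<^esub> monad.Tar (law (X, Q)) =
      law (X, Q) \<cdot>\<^bsub>M\<^esub> mu T (X \<lozenge>\<^bsub>A\<^esub> Q)"
proof -
  let ?h = "eta T X \<lozenge>\<^sub>m\<^bsub>A\<^esub> idm C Q" and ?s = "struct (free X) Q"
  \<comment> \<open>The first two factors are the lifted structure map itself, by
    \<open>struct_eq_law\<close> at the free module.\<close>
  have "(mu T X \<lozenge>\<^sub>m\<^bsub>A\<^esub> idm C Q) \<cdot>\<^bsub>M\<^esub> law (monad.Tob X, Q) \<cdot>\<^bsub>M\<^esub> monad.Tar (law (X, Q)) =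
    ?s \<cdot>\<^bsub>M\<^esub> monad.Tar (?s \<cdot>\<^bsub>M\<^esub> monad.Tar ?h)"
    using struct_eq_law[of "free X" Q] by (simp add: law_eq)
  also have "\<dots> = (?s \<cdot>\<^bsub>M\<^esub> monad.Tar ?s) \<cdot>\<^bsub>M\<^esub> monad.Tar (monad.Tar ?h)"
    by (simp add: monad.T.amap_comp_Ar)
  also have "\<dots> = ?s \<cdot>\<^bsub>M\<^esub> (mu T (monad.Tob X \<lozenge>\<^bsub>A\<^esub> Q) \<cdot>\<^bsub>M\<^esub> monad.Tar (monad.Tar ?h))"
    by (simp add: struct_assoc)
  also have "\<dots> = law (X, Q) \<cdot>\<^bsub>M\<^esub> mu T (X \<lozenge>\<^bsub>A\<^esub> Q)"
    using monad.mu_nat[of ?h] by (simp add: law_eq)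
  finally show ?thesis .
qed

text \<open>\<open>Psi\<close> is a module map on the free module; after naturality of
  \<open>Psi\<close> at \<open>\<eta>\<close> the remaining structure map is expressed through
  \<open>law\<close>.\<close>

lemma law_D2:
  assumes [simp]: "X \<in> Ob M" "Q \<in> Ob C" "R \<in> Ob C"
  shows "Psi A (monad.Tob X, Q, R) \<cdot>\<^bsub>M\<^esub> law (X, Q \<otimes>\<^bsub>C\<^esub> R) =
      (law (X, Q) \<lozenge>\<^sub>m\<^bsub>A\<^esub> idm C R) \<cdot>\<^bsub>M\<^esub> law (X \<lozenge>\<^bsub>A\<^esub> Q, R) \<cdot>\<^bsub>M\<^esub> monad.Tar (Psi A (X, Q, R))"
proof -
  let ?h = "eta T X \<lozenge>\<^sub>m\<^bsub>A\<^esub> idm C Q" and ?s = "struct (free X) Q"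
  let ?\<Psi> = "Psi A (X, Q, R)" and ?\<Psi>T = "Psi A (monad.Tob X, Q, R)"
  let ?sR = "struct (free X \<lozenge>\<^bsub>B\<^esub> Q) R"
  have mod [simp]: "is_module M T (free X \<lozenge>\<^bsub>B\<^esub> Q)"
    "fst (free X \<lozenge>\<^bsub>B\<^esub> Q) = monad.Tob X \<lozenge>\<^bsub>A\<^esub> Q"
    "snd (free X \<lozenge>\<^bsub>B\<^esub> Q) = ?s"
    using is_module_B[of "free X" Q] by (simp_all add: B_ob)
  have "?\<Psi>T \<cdot>\<^bsub>M\<^esub> law (X, Q \<otimes>\<^bsub>C\<^esub> R) =
    (?\<Psi>T \<cdot>\<^bsub>M\<^esub> struct (free X) (Q \<otimes>\<^bsub>C\<^esub> R)) \<cdot>\<^bsub>M\<^esub> monad.Tar (eta T X \<lozenge>\<^sub>m\<^bsub>A\<^esub> (idm C Q \<otimes>\<^sub>m\<^bsub>C\<^esub> idm C R))"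
    by (simp add: law_eq)
  also have "\<dots> = ?sR \<cdot>\<^bsub>M\<^esub> monad.Tar (?\<Psi>T \<cdot>\<^bsub>M\<^esub> (eta T X \<lozenge>\<^sub>m\<^bsub>A\<^esub> (idm C Q \<otimes>\<^sub>m\<^bsub>C\<^esub> idm C R)))"
    using struct_Psi[of "free X" Q R] by (simp add: monad.T.amap_comp_Ar flip: base.M.comp_assoc_Ar)
  also have "\<dots> = ?sR \<cdot>\<^bsub>M\<^esub> monad.Tar ((?h \<lozenge>\<^sub>m\<^bsub>A\<^esub> idm C R) \<cdot>\<^bsub>M\<^esub> ?\<Psi>)"
    using base.Psi_nat[of "eta T X" "idm C Q" "idm C R"] by (simp del: base.tensor_idm)
  \<comment> \<open>The structure on \<open>free X\<close> acted on by \<open>Q\<close> is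
    \<open>?s\<close>, in general not a free one, so \<open>struct_eq_law\<close> is needed to bring
    in \<open>law\<close>. Naturality at \<open>?h\<close> then lowers its index to \<open>X\<close>
    acted on by \<open>Q\<close>.\<close>
  also have "\<dots> = (?s \<lozenge>\<^sub>m\<^bsub>A\<^esub> idm C R) \<cdot>\<^bsub>M\<^esub>
      (law (monad.Tob X \<lozenge>\<^bsub>A\<^esub> Q, R) \<cdot>\<^bsub>M\<^esub> monad.Tar (?h \<lozenge>\<^sub>m\<^bsub>A\<^esub> idm C R)) \<cdot>\<^bsub>M\<^esub> monad.Tar ?\<Psi>"
    using struct_eq_law[of "free X \<lozenge>\<^bsub>B\<^esub> Q" R] by (simp add: monad.T.amap_comp_Ar)
  also have "\<dots> = ((?s \<lozenge>\<^sub>m\<^bsub>A\<^esub> idm C R) \<cdot>\<^bsub>M\<^esub> (monad.Tar ?h \<lozenge>\<^sub>m\<^bsub>A\<^esub> idm C R)) \<cdot>\<^bsub>M\<^esub>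
      law (X \<lozenge>\<^bsub>A\<^esub> Q, R) \<cdot>\<^bsub>M\<^esub> monad.Tar ?\<Psi>"
    using law_nat[of ?h "idm C R"] by simp
  also have "\<dots> = (law (X, Q) \<lozenge>\<^sub>m\<^bsub>A\<^esub> idm C R) \<cdot>\<^bsub>M\<^esub> law (X \<lozenge>\<^bsub>A\<^esub> Q, R) \<cdot>\<^bsub>M\<^esub> monad.Tar ?\<Psi>"
    by (subst base.act_comp) (simp_all add: law_eq)
  finally show ?thesis .
qed

text \<open>Naturality of \<open>\<eta>\<close> at \<open>?h\<close> reduces the claim to the unit
  axiom of the lifted free module.\<close>

lemma law_D3:
  assumes [simp]: "X \<in> Ob M" "Q \<in> Ob C"
  shows "law (X, Q) \<cdot>\<^bsub>M\<^esub> eta T (X \<lozenge>\<^bsub>A\<^esub> Q) = eta T X \<lozenge>\<^sub>m\<^bsub>A\<^esub> idm C Q"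
proof -
  let ?h = "eta T X \<lozenge>\<^sub>m\<^bsub>A\<^esub> idm C Q" and ?s = "struct (free X) Q"
  have "law (X, Q) \<cdot>\<^bsub>M\<^esub> eta T (X \<lozenge>\<^bsub>A\<^esub> Q) = (?s \<cdot>\<^bsub>M\<^esub> eta T (monad.Tob X \<lozenge>\<^bsub>A\<^esub> Q)) \<cdot>\<^bsub>M\<^esub> ?h"
    using monad.eta_nat[of ?h] by (simp add: law_eq)
  also have "\<dots> = ?h"
    using struct_assoc(2)[of "free X" Q] by (simp del: base.M.comp_assoc_Ar)
  finally show ?thesis .
qed

text \<open>Naturality of \<open>u\<close> at \<open>\<eta>\<close> lets \<open>struct_actu\<close>
  apply to the free module; what remains is \<open>\<mu>\<close> after \<open>T(\<eta>)\<close>, an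
  identity.\<close>

lemma law_D4:
  assumes [simp]: "X \<in> Ob M"
  shows "law (X, \<one>\<^bsub>C\<^esub>) \<cdot>\<^bsub>M\<^esub> monad.Tar (actu A X) = actu A (monad.Tob X)"
proof -
  let ?s = "struct (free X) \<one>\<^bsub>C\<^esub>"
  have "law (X, \<one>\<^bsub>C\<^esub>) \<cdot>\<^bsub>M\<^esub> monad.Tar (actu A X) =
    ?s \<cdot>\<^bsub>M\<^esub> monad.Tar ((eta T X \<lozenge>\<^sub>m\<^bsub>A\<^esub> idm C \<one>\<^bsub>C\<^esub>) \<cdot>\<^bsub>M\<^esub> actu A X)"
    by (simp add: law_eq monad.T.amap_comp_Ar)
  also have "\<dots> = ?s \<cdot>\<^bsub>M\<^esub> monad.Tar (actu A (monad.Tob X) \<cdot>\<^bsub>M\<^esub> eta T X)"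
    using base.actu_nat[of "eta T X"] by simp
  also have "\<dots> = (?s \<cdot>\<^bsub>M\<^esub> monad.Tar (actu A (monad.Tob X))) \<cdot>\<^bsub>M\<^esub> monad.Tar (eta T X)"
    by (simp add: monad.T.amap_comp_Ar)
  also have "\<dots> = actu A (monad.Tob X)"
    using struct_actu[of "free X"] by (simp add: monad.mu_eta_right)
  finally show ?thesis .
qed

lemma distributive_law_law: "distributive_law C M A T law"
proof -
  have MC: "category (M \<times>\<^sub>c C)"
    by (intro category_prod_cat base.M.category_axioms base.C.category_axioms)
  show ?thesis
  proof (intro distributive_law.intro nat_transI distributive_law_axioms.intro)
    show "is_functor (M \<times>\<^sub>c C) M
      \<lparr>omap = (\<lambda>(X, Q). monad.Tob (X \<lozenge>\<^bsub>A\<^esub> Q)), amap = (\<lambda>(f, g). monad.Tar (f \<lozenge>\<^sub>m\<^bsub>A\<^esub> g))\<rparr>"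
      by (rule is_functorI)
        (auto simp: Hom_def MC base.M.category_axioms simp flip: base.act_comp monad.T.amap_comp_Ar)
    show "is_functor (M \<times>\<^sub>c C) M
      \<lparr>omap = (\<lambda>(X, Q). monad.Tob X \<lozenge>\<^bsub>A\<^esub> Q), amap = (\<lambda>(f, g). monad.Tar f \<lozenge>\<^sub>m\<^bsub>A\<^esub> g)\<rparr>"
      by (rule is_functorI)
        (auto simp: Hom_def MC base.M.category_axioms base.act_comp monad.T.amap_comp_Ar)
  qed (auto simp: base.right_action_axioms monad.monad_on_axioms Hom_def law_nat law_D1 law_D2
      law_D3 law_D4)
qed

text \<open>Inside the categories both actions have the same structure maps by
  \<open>struct_eq_law\<close>, hence the same fields; outside, both are
  \<open>undefined\<close>.\<close>

lemma lift_of_law: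
  assumes ext: "extensional_action C (EM M T) B"
  shows "lift_of C M A T law = B"
proof -
  interpret law: distributive_law C M A T law by (rule distributive_law_law)
  have ob: "lift_ob_of C M A law P Q = P \<lozenge>\<^bsub>B\<^esub> Q" if "is_module M T P" "Q \<in> Ob C" for P Q
    using that by (simp add: prod_eq_iff B_ob struct_eq_law)
  note ext = ext[unfolded extensional_action_def] law.extensional_lift[unfolded extensional_action_def]
  have "omap (Act law.lift) = omap (Act B)"
    by (rule extensionalityI[of _ "Ob (EM M T) \<times> Ob C"]) (use ext in \<open>auto simp: law.lift_simps ob\<close>)
  moreover have "amap (Act law.lift) = amap (Act B)"
    by (rule extensionalityI[of _ "Ar (EM M T) \<times> Ar C"]) (use ext in \<open>auto simp: law.lift_simps ob B_ar\<close>)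
  moreover have "Psi law.lift = Psi B"
    by (rule extensionalityI[of _ "Ob (EM M T) \<times> Ob C \<times> Ob C"])
      (use ext in \<open>auto simp: law.lift_simps ob B_Psi is_module_B\<close>)
  moreover have "actu law.lift = actu B"
    by (rule extensionalityI[of _ "Ob (EM M T)"]) (use ext in \<open>auto simp: law.lift_simps ob B_actu\<close>)
  ultimately show ?thesis by simp
qed

end

section \<open>Bijectivity of the passage from laws to lifts\<close>

theorem mainTheorem1:
  fixes C :: "('c, 'd) moncat" and M :: "('o, 'm) cat"
    and A :: "('o, 'm, 'c, 'd) action" and T :: "('o, 'm) monad"
  assumes "monoidal_category C" and "category M"
    and "right_action C M A" and "monad_on M T"
  shows "bij_betw (lift_of C M A T) (distributive_laws C M A T) (strict_lifts C M A T)"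
proof (rule bij_betwI')
  fix l l' assume "l \<in> distributive_laws C M A T" "l' \<in> distributive_laws C M A T"
  then have d: "distributive_law C M A T l" "distributive_law C M A T l'"
    and ext: "l \<in> extensional (Ob M \<times> Ob C)" "l' \<in> extensional (Ob M \<times> Ob C)"
    by (auto simp: distributive_laws_def)
  interpret l: distributive_law C M A T l by fact
  interpret l': distributive_law C M A T l' by fact
  have "l = l'" if eq: "l.lift = l'.lift"
  proof (rule extensionalityI[OF ext])
    fix x assume "x \<in> Ob M \<times> Ob C"
    then obtain X Q where x: "x = (X, Q)" "X \<in> Ob M" "Q \<in> Ob C" by auto
    \<comment> \<open>Injectivity is tested on free modules only, since
      \<open>lift_free_module\<close> recovers a law from the lifted structure there.\<close>
    let ?P = "(l.monad.Tob X, mu T X)"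
    have "l.lift_ob ?P Q = l'.lift_ob ?P Q"
      using l.lift_simps(1)[of ?P Q] l'.lift_simps(1)[of ?P Q] x l.monad.is_module_free eq by simp
    then show "l x = l' x"
      using l.lift_free_module l'.lift_free_module x by metis
  qed
  then show "l.lift = l'.lift \<longleftrightarrow> l = l'" by auto
next
  fix l assume "l \<in> distributive_laws C M A T"
  then interpret l: distributive_law C M A T l by (simp add: distributive_laws_def)
  show "l.lift \<in> strict_lifts C M A T"
    by (simp add: strict_lifts_def l.strict_lift_lift l.extensional_lift)
next
  fix B assume "B \<in> strict_lifts C M A T"
  then have B: "strict_lift C (EM M T) M forgetful A B" "extensional_action C (EM M T) B"
    by (auto simp: strict_lifts_def)
  \<comment> \<open>Supplies the preimage of \<open>B\<close>, namely \<open>law\<close>.\<close>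
  interpret em_lift C M A T B
    using B(1) assms(4) by (rule em_lift.intro)
  have "law \<in> extensional (Ob M \<times> Ob C)"
    by (simp add: law_def)
  then have "law \<in> distributive_laws C M A T"
    by (simp add: distributive_laws_def distributive_law_law)
  then show "\<exists>l \<in> distributive_laws C M A T. B = lift_of C M A T l"
    using lift_of_law[OF B(2)] by metis
qed

end
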